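(* Conditioned on the event $\mathcal{E}_0$, the CDF and PDF of the serving distance $R$ are, for $r\ge0$, $$F_R(r\mid\mathcal{E}_0)=1-\frac1{\mathbb{P}(\mathcal{E}_0)}\int_r^\infty\big(F_{S_0}(v_0)-F_{S_0}(r)\big)f_{V_0}(v_0)\,\mathrm{d}v_0,\qquad f_R(r\mid\mathcal{E}_0)=\frac1{\mathbb{P}(\mathcal{E}_0)}\int_r^\infty f_{S_0}(r)f_{V_0}(v_0)\,\mathrm{d}v_0,$$ where $F_{S_0}(s)=1-e^{-2\lambda_v s}$, $f_{S_0}(s)=2\lambda_v e^{-2\lambda_v s}$, $$f_{V_0}(v)=2\pi\lambda_l\int_0^v e^{-2\lambda_v\sqrt{v^2-z^2}}\frac{2\lambda_v v}{\sqrt{v^2-z^2}}\,\mathrm{d}z\;\exp\Big[-2\pi\lambda_l\int_0^v\big(1-e^{-2\lambda_v\sqrt{v^2-z^2}}\big)\mathrm{d}z\Big],$$ and $\mathbb{P}(\mathcal{E}_0)=\int_0^\infty F_{S_0}(v_0)f_{V_0}(v_0)\,\mathrm{d}v_0$.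
   Context: Fix $\lambda_l,\lambda_v>0$. An undirected line in $\mathbb{R}^2$ is described by $(\theta,\rho)\in[0,2\pi)\times[0,\infty)$, where $\rho$ is its perpendicular distance from the origin $o$ and $\theta$ the angle of the perpendicular with the positive $x$-axis. $\Phi_l$ is the Poisson line process whose $(\theta,\rho)$ points form a homogeneous Poisson point process (PPP) of intensity $\lambda_l$ on $[0,2\pi)\times[0,\infty)$. $L_0$ (the typical line) is an additional line through $o$. Given the lines, each line of $\Phi_l\cup\{L_0\}$ carries an independent homogeneous 1D PPP of intensity $\lambda_v$, whose points are called nodes. The typical receiver is at $o$ and is served by the node nearest to $o$ (on any line); $R$ is its distance from $o$; $\mathcal{E}_0$ is the event that the serving node lies on $L_0$. $S_0$ is the distance from $o$ to the closest node on $L_0$, and $V_0$ is the distance from $o$ to the closest node on the lines of $\Phi_l$; $F_{S_0},f_{S_0},f_{V_0}$ denote their CDF/PDFs. *)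

theory Defs
  imports "HOL-Probability.Probability"
begin

text \<open>Locally finite configurations of points in \<open>S\<close>, with the \<open>\<sigma>\<close>-algebra generated by the
  counting maps. Restricting to bounded \<open>B\<close> makes \<^term>\<open>card\<close> the true number of points.\<close>

definition config_space :: "'b::euclidean_space set \<Rightarrow> 'b set measure" where
  "config_space S =
     (let C = {A. A \<subseteq> S \<and> (\<forall>B. bounded B \<longrightarrow> finite (A \<inter> B))}
      in sigma C {{A \<in> C. card (A \<inter> B) = n} | B n. B \<in> sets borel \<and> bounded B})"

text \<open>The Poisson probabilities are written out because the library's \<open>poisson_pmf\<close> requires a
  positive rate, whereas \<open>B\<close> may be a null set here.\<close>

definition (in prob_space) homogeneous_PPP ::
    "real \<Rightarrow> 'b::euclidean_space set \<Rightarrow> ('a \<Rightarrow> 'b set) \<Rightarrow> bool" where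
  "homogeneous_PPP lam S X \<longleftrightarrow>
     X \<in> measurable M (config_space S) \<and>
     (\<forall>B k. B \<in> sets borel \<and> bounded B \<and> B \<subseteq> S \<longrightarrow>
        prob {\<omega> \<in> space M. card (X \<omega> \<inter> B) = k} =
          (lam * measure lborel B) ^ k / fact k * exp (- (lam * measure lborel B))) \<and>
     (\<forall>(n::nat) B. (\<forall>i<n. B i \<in> sets borel \<and> bounded (B i) \<and> B i \<subseteq> S) \<and>
          disjoint_family_on B {..<n} \<longrightarrow>
        indep_vars (\<lambda>_. count_space UNIV) (\<lambda>i \<omega>. card (X \<omega> \<inter> B i)) {..<n})"

text \<open>The line \<open>(\<theta>, \<rho>)\<close> is parametrised by the signed arc length \<open>t\<close> from the foot of the
  perpendicular from the origin.\<close>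

definition line_point :: "real \<times> real \<Rightarrow> real \<Rightarrow> real \<times> real" where
  "line_point = (\<lambda>(\<theta>, \<rho>) t. (\<rho> * cos \<theta> - t * sin \<theta>, \<rho> * sin \<theta> + t * cos \<theta>))"

lemma range_line_point:
  "range (line_point (\<theta>, \<rho>)) = {(x, y). x * cos \<theta> + y * sin \<theta> = \<rho>}"
proof (intro equalityI subsetI)
  fix p assume "p \<in> range (line_point (\<theta>, \<rho>))"
  then obtain t where p: "p = (\<rho> * cos \<theta> - t * sin \<theta>, \<rho> * sin \<theta> + t * cos \<theta>)"
    by (auto simp: line_point_def)
  have "(\<rho> * cos \<theta> - t * sin \<theta>) * cos \<theta> + (\<rho> * sin \<theta> + t * cos \<theta>) * sin \<theta>
      = \<rho> * ((sin \<theta>)\<^sup>2 + (cos \<theta>)\<^sup>2)"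
    by algebra
  then show "p \<in> {(x, y). x * cos \<theta> + y * sin \<theta> = \<rho>}"
    by (simp add: p)
next
  fix p assume "p \<in> {(x, y). x * cos \<theta> + y * sin \<theta> = \<rho>}"
  then obtain x y where p: "p = (x, y)" and \<rho>: "\<rho> = x * cos \<theta> + y * sin \<theta>"
    by (cases p) auto
  have "\<rho> * cos \<theta> - (y * cos \<theta> - x * sin \<theta>) * sin \<theta> = x * ((sin \<theta>)\<^sup>2 + (cos \<theta>)\<^sup>2)"
       "\<rho> * sin \<theta> + (y * cos \<theta> - x * sin \<theta>) * cos \<theta> = y * ((sin \<theta>)\<^sup>2 + (cos \<theta>)\<^sup>2)"
    unfolding \<rho> by algebra+
  then have "p = line_point (\<theta>, \<rho>) (y * cos \<theta> - x * sin \<theta>)"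
    by (simp add: p line_point_def)
  then show "p \<in> range (line_point (\<theta>, \<rho>))" by blast
qed

lemma dist_line_point: "dist (line_point l s) (line_point l t) = \<bar>s - t\<bar>"
proof (cases l)
  case (Pair \<theta> \<rho>)
  have "(\<rho> * cos \<theta> - s * sin \<theta> - (\<rho> * cos \<theta> - t * sin \<theta>))\<^sup>2
      + (\<rho> * sin \<theta> + s * cos \<theta> - (\<rho> * sin \<theta> + t * cos \<theta>))\<^sup>2
      = (s - t)\<^sup>2 * ((sin \<theta>)\<^sup>2 + (cos \<theta>)\<^sup>2)"
    by algebra
  then show ?thesis
    by (simp only: Pair line_point_def dist_Pair_Pair dist_real_def prod.case power2_abs
        sin_cos_squared_add real_sqrt_abs mult_1_right)
qed

text \<open>The lines of \<open>\<Phi>\<close> (almost surely infinitely many) are enumerated by \<open>L\<close>, and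
  \<open>N (Some i)\<close> is the node process on the line \<open>L i\<close> in arc-length coordinates; \<open>N None\<close> is the one
  on the typical line through the origin, whose normal has an arbitrary fixed angle \<open>\<theta>\<^sub>0\<close>. As the law
  of a node process in these coordinates is the same for every line, conditional independence of
  the node processes given the lines, each being a PPP, means that they are independent PPPs
  which are jointly independent of the lines.\<close>

locale poisson_line_cox = prob_space M for M :: "'a measure" +
  fixes lam\<^sub>l lam\<^sub>v :: real
    and \<Phi> :: "'a \<Rightarrow> (real \<times> real) set"
    and L :: "nat \<Rightarrow> 'a \<Rightarrow> real \<times> real"
    and N :: "nat option \<Rightarrow> 'a \<Rightarrow> real set"
  assumes intensity_lines_pos: "0 < lam\<^sub>l"
    and intensity_nodes_pos: "0 < lam\<^sub>v"
    and lines_PPP: "homogeneous_PPP lam\<^sub>l ({0..<2 * pi} \<times> {0..}) \<Phi>"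
    and lines_measurable: "\<And>i. L i \<in> borel_measurable M"
    and lines_enum: "AE \<omega> in M. bij_betw (\<lambda>i. L i \<omega>) UNIV (\<Phi> \<omega>)"
    and nodes_PPP: "\<And>j. homogeneous_PPP lam\<^sub>v UNIV (N j)"
    and nodes_indep: "indep_vars (\<lambda>_. config_space UNIV) N UNIV"
    and nodes_indep_lines:
      "indep_set
         (sets (vimage_algebra (space M) (\<lambda>\<omega> i. L i \<omega>) (\<Pi>\<^sub>M i\<in>UNIV. borel)))
         (sets (vimage_algebra (space M) (\<lambda>\<omega> j. N j \<omega>) (\<Pi>\<^sub>M j\<in>UNIV. config_space UNIV)))"

definition typical_line_nodes ::
    "real \<Rightarrow> (nat option \<Rightarrow> 'a \<Rightarrow> real set) \<Rightarrow> 'a \<Rightarrow> (real \<times> real) set" where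
  "typical_line_nodes \<theta>\<^sub>0 N \<omega> = line_point (\<theta>\<^sub>0, 0) ` N None \<omega>"

definition other_line_nodes ::
    "(nat \<Rightarrow> 'a \<Rightarrow> real \<times> real) \<Rightarrow> (nat option \<Rightarrow> 'a \<Rightarrow> real set) \<Rightarrow> 'a \<Rightarrow> (real \<times> real) set" where
  "other_line_nodes L N \<omega> = (\<Union>i. line_point (L i \<omega>) ` N (Some i) \<omega>)"

definition all_nodes ::
    "real \<Rightarrow> (nat \<Rightarrow> 'a \<Rightarrow> real \<times> real) \<Rightarrow> (nat option \<Rightarrow> 'a \<Rightarrow> real set) \<Rightarrow> 'a
      \<Rightarrow> (real \<times> real) set" where
  "all_nodes \<theta>\<^sub>0 L N \<omega> = typical_line_nodes \<theta>\<^sub>0 N \<omega> \<union> other_line_nodes L N \<omega>"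

text \<open>\<^term>\<open>infdist\<close> to the empty set is \<open>0\<close>, but almost surely none of the node sets below is
  empty, and the infimum is attained.\<close>

definition S0_dist :: "real \<Rightarrow> (nat option \<Rightarrow> 'a \<Rightarrow> real set) \<Rightarrow> 'a \<Rightarrow> real" where
  "S0_dist \<theta>\<^sub>0 N \<omega> = infdist 0 (typical_line_nodes \<theta>\<^sub>0 N \<omega>)"

definition V0_dist ::
    "(nat \<Rightarrow> 'a \<Rightarrow> real \<times> real) \<Rightarrow> (nat option \<Rightarrow> 'a \<Rightarrow> real set) \<Rightarrow> 'a \<Rightarrow> real" where
  "V0_dist L N \<omega> = infdist 0 (other_line_nodes L N \<omega>)"

definition serving_dist ::
    "real \<Rightarrow> (nat \<Rightarrow> 'a \<Rightarrow> real \<times> real) \<Rightarrow> (nat option \<Rightarrow> 'a \<Rightarrow> real set) \<Rightarrow> 'a \<Rightarrow> real" where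
  "serving_dist \<theta>\<^sub>0 L N \<omega> = infdist 0 (all_nodes \<theta>\<^sub>0 L N \<omega>)"

definition serving_on_typical ::
    "'a measure \<Rightarrow> real \<Rightarrow> (nat \<Rightarrow> 'a \<Rightarrow> real \<times> real) \<Rightarrow> (nat option \<Rightarrow> 'a \<Rightarrow> real set) \<Rightarrow> 'a set"
  where
  "serving_on_typical M \<theta>\<^sub>0 L N =
     {\<omega> \<in> space M. \<exists>x \<in> typical_line_nodes \<theta>\<^sub>0 N \<omega>. \<forall>y \<in> all_nodes \<theta>\<^sub>0 L N \<omega>. dist 0 x \<le> dist 0 y}"

definition F_S0 :: "real \<Rightarrow> real \<Rightarrow> real" where
  "F_S0 lam\<^sub>v s = (if s < 0 then 0 else 1 - exp (- 2 * lam\<^sub>v * s))"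

definition f_S0 :: "real \<Rightarrow> real \<Rightarrow> real" where
  "f_S0 lam\<^sub>v s = (if s < 0 then 0 else 2 * lam\<^sub>v * exp (- 2 * lam\<^sub>v * s))"

definition f_V0 :: "real \<Rightarrow> real \<Rightarrow> real \<Rightarrow> real" where
  "f_V0 lam\<^sub>l lam\<^sub>v v =
     (if v < 0 then 0 else
        2 * pi * lam\<^sub>l
        * (LBINT z:{0..v}. exp (- 2 * lam\<^sub>v * sqrt (v\<^sup>2 - z\<^sup>2)) * (2 * lam\<^sub>v * v / sqrt (v\<^sup>2 - z\<^sup>2)))
        * exp (- 2 * pi * lam\<^sub>l * (LBINT z:{0..v}. 1 - exp (- 2 * lam\<^sub>v * sqrt (v\<^sup>2 - z\<^sup>2)))))"

end

theory Submission
  imports Defs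
begin

text \<open>No node of the lines of \<open>\<Phi>\<close> lies in the open ball of radius \<open>v\<close> around the origin iff each line at distance
  \<open>\<rho> < v\<close> has no node at arc length below \<open>sqrt (v\<^sup>2 - \<rho>\<^sup>2)\<close> from its foot. Given the lines, this has
  probability \<open>\<Prod> exp (- 2 * lam\<^sub>v * sqrt (v\<^sup>2 - \<rho>\<^sup>2))\<close>, and the probability generating functional of the
  line process turns the mean of the product into
  \<open>exp (- 2 * pi * lam\<^sub>l * (LBINT z:{0..v}. 1 - exp (- 2 * lam\<^sub>v * sqrt (v\<^sup>2 - z\<^sup>2))))\<close>. Carrying the typical
  line along shows that the joint tail of \<open>S\<^sub>0\<close> and \<open>V\<^sub>0\<close> factorises, so the two are independent, and
  differentiating the exponent gives the density of \<open>V\<^sub>0\<close>. Almost surely the serving node is on the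
  typical line iff \<open>S\<^sub>0 \<le> V\<^sub>0\<close>, and then \<open>R = S\<^sub>0\<close>; the rest is Fubini's theorem.\<close>

text \<open>\<open>homogeneous_PPP\<close> supplies only Poisson counts on bounded Borel sets and
  their independence over disjoint sets, while the lines form an almost surely infinite sequence.
  The generating functional is therefore built from counts on level sets of simple functions, on a
  bounded strip. The product over all lines arises as a limit over the first \<open>n\<close>: their
  void events decrease, and almost surely only finitely many factors differ from 1. Open balls
  appear throughout because, for nonempty \<open>A\<close>, \<open>r \<le> infdist 0 A\<close> says
  exactly that the open ball of radius \<open>r\<close> misses \<open>A\<close>. Nonemptiness itself
  comes from void probabilities tending to 0, so these precede every statement about distances. A
  ball of negative radius is empty and \<open>sqrt\<close> of a negative number is negative, so a
  line that misses the ball imposes no condition; clipping with \<open>max 0\<close> then gives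
  formulas for all real radii. The joint law on the region \<open>s \<le> v\<close> is integrated in
  both orders: one gives the probability of the serving event and the conditional CDF, the other
  gives the conditional density directly, without differentiating the CDF.\<close>

section \<open>The exponent of the void probability\<close>

text \<open>The integral of \<open>1 - exp (- 2 * \<mu> * sqrt (v\<^sup>2 - z\<^sup>2))\<close> over \<open>0 \<le> z \<le> v\<close> after the substitution
  \<open>z = v * x\<close>: with fixed limits and an integrand smooth in \<open>v\<close>, it can be differentiated under the
  integral sign at every real \<open>v\<close>, although the density of \<open>V\<^sub>0\<close> has a singular integrand.\<close>

definition void_exponent :: "real \<Rightarrow> real \<Rightarrow> real" where
  "void_exponent \<mu> v = v * integral {0..1} (\<lambda>x. 1 - exp (- 2 * \<mu> * v * sqrt (1 - x\<^sup>2)))"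

text \<open>Product rule plus differentiation under the integral. Both integrands are jointly
  continuous in \<open>v\<close> and \<open>x\<close>, so continuity in \<open>v\<close> is
  immediate; the integrand in \<open>f_V0\<close> is singular at \<open>z = v\<close>.\<close>

definition void_exponent_deriv :: "real \<Rightarrow> real \<Rightarrow> real" where
  "void_exponent_deriv \<mu> v =
     integral {0..1} (\<lambda>x. 1 - exp (- 2 * \<mu> * v * sqrt (1 - x\<^sup>2))) +
     v * integral {0..1} (\<lambda>x. 2 * \<mu> * sqrt (1 - x\<^sup>2) * exp (- 2 * \<mu> * v * sqrt (1 - x\<^sup>2)))"

lemma set_lebesgue_integral_rescale:
  fixes f :: "real \<Rightarrow> real"
  assumes "v > 0"
  shows "(LBINT z:{0..v}. f z) = v * (LBINT x:{0..1}. f (v * x))"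
proof -
  have "indicator {0..v} (v * x) = (indicator {0..1} x :: real)" for x
    using assms by (auto simp: indicator_def zero_le_mult_iff)
  then show ?thesis
    using assms lborel_integral_real_affine[of v "\<lambda>z. indicator {0..v} z *\<^sub>R f z" 0]
    by (simp add: set_lebesgue_integral_def)
qed

lemma sqrt_diff_square_scale:
  assumes "v > 0"
  shows "sqrt (v\<^sup>2 - (v * x)\<^sup>2) = v * sqrt (1 - x\<^sup>2)"
proof -
  have "v\<^sup>2 - (v * x)\<^sup>2 = v\<^sup>2 * (1 - x\<^sup>2)" by (simp add: algebra_simps power_mult_distrib)
  then show ?thesis using assms by (simp add: real_sqrt_mult)
qed

lemma continuous_on_imp_LBINT_eq_integral:
  fixes f :: "real \<Rightarrow> real"
  assumes "continuous_on {a..b} f"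
  shows "(LBINT x:{a..b}. f x) = integral {a..b} f"
  using set_borel_integral_eq_integral(2)[of "{a..b}" f] borel_integrable_atLeastAtMost'[OF assms]
  by simp

lemma void_exponent_eq_LBINT:
  assumes "v \<ge> 0"
  shows "void_exponent \<mu> v = (LBINT z:{0..v}. 1 - exp (- 2 * \<mu> * sqrt (v\<^sup>2 - z\<^sup>2)))"
proof (cases "v = 0")
  case True
  then show ?thesis
    using continuous_on_imp_LBINT_eq_integral[of 0 0 "\<lambda>z. 1 - exp (- 2 * \<mu> * sqrt (v\<^sup>2 - z\<^sup>2))"]
    by (simp add: void_exponent_def)
next
  case False
  with assms have "v > 0" by simp
  have "(LBINT x:{0..1}. 1 - exp (- 2 * \<mu> * v * sqrt (1 - x\<^sup>2)))
      = integral {0..1} (\<lambda>x. 1 - exp (- 2 * \<mu> * v * sqrt (1 - x\<^sup>2)))"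
    by (intro continuous_on_imp_LBINT_eq_integral continuous_intros)
  with \<open>v > 0\<close> show ?thesis
    by (subst set_lebesgue_integral_rescale)
      (simp_all add: void_exponent_def sqrt_diff_square_scale mult.assoc)
qed

lemma has_real_derivative_void_exponent:
  "(void_exponent \<mu> has_real_derivative void_exponent_deriv \<mu> v) (at v)"
proof -
  have "((\<lambda>v. integral (cbox 0 1) (\<lambda>x. 1 - exp (- 2 * \<mu> * v * sqrt (1 - x\<^sup>2))))
      has_field_derivative
      integral (cbox 0 1) (\<lambda>x. 2 * \<mu> * sqrt (1 - x\<^sup>2) * exp (- 2 * \<mu> * v * sqrt (1 - x\<^sup>2))))
      (at v within UNIV)"
  proof (rule leibniz_rule_field_derivative)
    show "continuous_on (UNIV \<times> cbox 0 1)
       (\<lambda>(v, x). 2 * \<mu> * sqrt (1 - x\<^sup>2) * exp (- 2 * \<mu> * v * sqrt (1 - x\<^sup>2)))"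
      by (auto simp: split_beta intro!: continuous_intros)
    show "(\<lambda>x. 1 - exp (- 2 * \<mu> * v * sqrt (1 - x\<^sup>2))) integrable_on cbox 0 1" for v
      by (intro integrable_continuous continuous_intros)
  qed (auto intro!: derivative_eq_intros)
  then show ?thesis
    unfolding void_exponent_def [abs_def] void_exponent_deriv_def
    by (auto intro!: derivative_eq_intros)
qed

lemma continuous_on_void_exponent_deriv: "continuous_on UNIV (void_exponent_deriv \<mu>)"
proof -
  have "continuous_on UNIV (\<lambda>v. integral (cbox 0 1)
      (\<lambda>x. 1 - exp (- 2 * \<mu> * v * sqrt (1 - x\<^sup>2))))"
    "continuous_on UNIV (\<lambda>v. integral (cbox 0 1)
      (\<lambda>x. 2 * \<mu> * sqrt (1 - x\<^sup>2) * exp (- 2 * \<mu> * v * sqrt (1 - x\<^sup>2))))"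
    by (rule integral_continuous_on_param; auto simp: split_beta intro!: continuous_intros)+
  then show ?thesis
    unfolding void_exponent_deriv_def [abs_def] by (auto intro!: continuous_intros)
qed

text \<open>The two forms of the derivative differ by the derivative of
  \<open>x * (1 - exp (- 2 * \<mu> * v * sqrt (1 - x\<^sup>2)))\<close>, which vanishes at both endpoints.\<close>

lemma has_integral_void_exponent_deriv:
  "((\<lambda>x. exp (- 2 * \<mu> * v * sqrt (1 - x\<^sup>2)) * (2 * \<mu> * v / sqrt (1 - x\<^sup>2)))
     has_integral void_exponent_deriv \<mu> v) {0..1}"
proof -
  define s e where "s x = sqrt (1 - x\<^sup>2)" and "e x = exp (- 2 * \<mu> * v * s x)" for x
  define B where "B x = (1 - e x) - 2 * \<mu> * v * x\<^sup>2 / s x * e x" for x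
  have B: "(B has_integral 1 * (1 - e 1) - 0 * (1 - e 0)) {0..1}"
  \<comment> \<open>\<open>B\<close> is singular at \<open>x = 1\<close>, so the derivative is taken
    only in the open interval, while the primitive is continuous up to both endpoints.\<close>
  proof (rule fundamental_theorem_of_calculus_interior)
    show "continuous_on {0..1} (\<lambda>x. x * (1 - e x))"
      unfolding e_def s_def by (intro continuous_intros)
    fix x :: real assume x: "x \<in> {0<..<1}"
    then have "x\<^sup>2 < 1" by (simp add: power_less_one_iff)
    then have "(s has_real_derivative - x / s x) (at x)"
      unfolding s_def by (auto intro!: derivative_eq_intros simp: field_simps)
    note [derivative_intros] = this
    have "((\<lambda>x. x * (1 - e x)) has_real_derivative B x) (at x)"
      unfolding e_def B_def
      by (auto intro!: derivative_eq_intros simp: field_simps power2_eq_square)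
    then show "((\<lambda>x. x * (1 - e x)) has_vector_derivative B x) (at x)"
      by (simp add: has_real_derivative_iff_has_vector_derivative)
  qed simp
  have "(\<lambda>x. 1 - e x) integrable_on {0..1}" "(\<lambda>x. 2 * \<mu> * s x * e x) integrable_on {0..1}"
    unfolding e_def s_def by (intro integrable_continuous_real continuous_intros)+
  then have "((\<lambda>x. (1 - e x) + v * (2 * \<mu> * s x * e x) - B x) has_integral
      (integral {0..1} (\<lambda>x. 1 - e x) + v * integral {0..1} (\<lambda>x. 2 * \<mu> * s x * e x)
        - (1 * (1 - e 1) - 0 * (1 - e 0)))) {0..1}"
    by (intro has_integral_diff has_integral_add has_integral_mult_right B integrable_integral)
  moreover have "(1 - e x) + v * (2 * \<mu> * s x * e x) - B x = e x * (2 * \<mu> * v / s x)"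
    if "x \<in> {0..1}" for x
  proof (cases "x = 1")
    \<comment> \<open>Here \<open>s 1 = 0\<close> and \<open>e 1 = 1\<close>; division by zero
      yields 0, so both sides vanish.\<close>
    case True
    then show ?thesis by (simp add: B_def e_def s_def)
  next
    case False
    with that have "x\<^sup>2 < 1" by (simp add: power_less_one_iff)
    then have "s x > 0" and "s x * s x = 1 - x * x"
      by (auto simp: s_def simp flip: power2_eq_square)
    have "(1 - e x) + v * (2 * \<mu> * s x * e x) - B x
        = e x * (2 * \<mu> * v) * (s x * s x + x * x) / s x"
      using \<open>s x > 0\<close> by (simp add: B_def field_simps power2_eq_square)
    then show ?thesis unfolding \<open>s x * s x = 1 - x * x\<close> by simp
  qed
  ultimately have "((\<lambda>x. e x * (2 * \<mu> * v / s x)) has_integral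
      (integral {0..1} (\<lambda>x. 1 - e x) + v * integral {0..1} (\<lambda>x. 2 * \<mu> * s x * e x)
        - (1 * (1 - e 1) - 0 * (1 - e 0)))) {0..1}"
    by (rule has_integral_eq [rotated])
  then show ?thesis
    by (simp add: void_exponent_deriv_def e_def s_def)
qed

lemma void_exponent_deriv_nonneg:
  assumes "v \<ge> 0" "\<mu> > 0"
  shows "void_exponent_deriv \<mu> v \<ge> 0"
  by (rule has_integral_nonneg [OF has_integral_void_exponent_deriv])
     (use assms in \<open>auto simp: abs_square_le_1\<close>)

text \<open>After rescaling to \<open>{0..1}\<close> the integrand is nonnegative, so its gauge
  integral is also its Lebesgue integral despite the singularity at the right endpoint.\<close>

lemma void_exponent_deriv_eq_LBINT:
  assumes "v \<ge> 0" "\<mu> > 0"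
  shows "void_exponent_deriv \<mu> v = (LBINT z:{0..v}. exp (- 2 * \<mu> * sqrt (v\<^sup>2 - z\<^sup>2)) *
           (2 * \<mu> * v / sqrt (v\<^sup>2 - z\<^sup>2)))"
proof (cases "v = 0")
  case True
  then show ?thesis by (simp add: void_exponent_deriv_def set_lebesgue_integral_def)
next
  case False
  with assms have v: "v > 0" by simp
  let ?h = "\<lambda>x. exp (- 2 * \<mu> * v * sqrt (1 - x\<^sup>2)) * (2 * \<mu> * v / sqrt (1 - x\<^sup>2))"
  have "(\<integral>\<^sup>+x. ennreal (indicator {0..1} x * ?h x) \<partial>lborel) = void_exponent_deriv \<mu> v"
    using assms by (intro nn_integral_has_integral_lebesgue has_integral_void_exponent_deriv)
      (auto simp: abs_square_le_1)
  then have "(LBINT x:{0..1}. ?h x) = void_exponent_deriv \<mu> v"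
    using assms void_exponent_deriv_nonneg[OF assms]
    by (subst set_lebesgue_integral_def, subst integral_eq_nn_integral)
      (auto simp: indicator_def abs_square_le_1)
  moreover have "v * (LBINT x:{0..1}. exp (- 2 * \<mu> * (v * sqrt (1 - x\<^sup>2))) *
        (2 * \<mu> * v / (v * sqrt (1 - x\<^sup>2)))) = (LBINT x:{0..1}. ?h x)"
    using v by (subst set_integral_mult_right[symmetric])
      (intro arg_cong[where f="\<lambda>f. set_lebesgue_integral lborel {0..1} f"], auto simp: fun_eq_iff mult.assoc)
  moreover have "(LBINT z:{0..v}. exp (- 2 * \<mu> * sqrt (v\<^sup>2 - z\<^sup>2)) * (2 * \<mu> * v / sqrt (v\<^sup>2 - z\<^sup>2)))
      = v * (LBINT x:{0..1}. exp (- 2 * \<mu> * (v * sqrt (1 - x\<^sup>2))) *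
        (2 * \<mu> * v / (v * sqrt (1 - x\<^sup>2))))"
    using v by (subst set_lebesgue_integral_rescale) (simp_all only: sqrt_diff_square_scale)
  ultimately show ?thesis by simp
qed

lemma f_V0_eq:
  assumes "\<mu> > 0"
  shows "f_V0 lam \<mu> v = (if v < 0 then 0 else
    2 * pi * lam * void_exponent_deriv \<mu> v * exp (- 2 * pi * lam * void_exponent \<mu> v))"
  using assms by (simp add: f_V0_def void_exponent_deriv_eq_LBINT void_exponent_eq_LBINT)

lemma f_V0_nonneg:
  assumes "\<mu> > 0" "lam > 0"
  shows "f_V0 lam \<mu> v \<ge> 0"
  using assms by (simp add: f_V0_eq void_exponent_deriv_nonneg)

lemma borel_measurable_f_V0 [measurable]:
  assumes "\<mu> > 0"
  shows "f_V0 lam \<mu> \<in> borel_measurable borel"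
proof -
  have [measurable]: "void_exponent_deriv \<mu> \<in> borel_measurable borel"
    "void_exponent \<mu> \<in> borel_measurable borel"
    using has_real_derivative_void_exponent
    by (auto intro!: borel_measurable_continuous_onI continuous_on_void_exponent_deriv
        DERIV_continuous_on)
  show ?thesis
    unfolding f_V0_eq[OF assms, abs_def] by measurable
qed

text \<open>The growth is at least linear: for \<open>x \<le> 1/2\<close> one has
  \<open>sqrt (1 - x\<^sup>2) \<ge> 1/2\<close>, so for \<open>v \<ge> 1\<close> the integrand is at
  least \<open>1 - exp (- \<mu>)\<close> on half of the interval. This makes void probabilities
  vanish at infinity and gives the density of \<open>V0_dist\<close> total mass 1.\<close>

lemma filterlim_void_exponent:
  assumes "\<mu> > 0"
  shows "filterlim (void_exponent \<mu>) at_top at_top"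
proof (rule filterlim_at_top_mono)
  show "filterlim (\<lambda>v. v * ((1 - exp (- \<mu>)) / 2)) at_top at_top"
    using assms by real_asymp
  show "\<forall>\<^sub>F v in at_top. v * ((1 - exp (- \<mu>)) / 2) \<le> void_exponent \<mu> v"
    using eventually_ge_at_top[of 1]
  proof eventually_elim
    case (elim v)
    let ?f = "\<lambda>x::real. 1 - exp (- 2 * \<mu> * v * sqrt (1 - x\<^sup>2))"
    have int: "?f integrable_on {a..b}" for a b
      by (intro integrable_continuous_real continuous_intros)
    have nonneg: "0 \<le> ?f x" if "x \<in> {0..1}" for x
      using that assms elim by (simp add: abs_square_le_1)
    have "(1 - exp (- \<mu>)) / 2 = integral {0..1/2} (\<lambda>x::real. 1 - exp (- \<mu>))"
      by simp
    also have "\<dots> \<le> integral {0..1/2} ?f"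
    proof (rule integral_le[OF _ int])
      fix x :: real assume "x \<in> {0..1/2}"
      then have "x\<^sup>2 \<le> (1/2)\<^sup>2" by (intro power_mono) auto
      then have "(1/2) \<le> sqrt (1 - x\<^sup>2)"
        by (intro real_le_rsqrt) (simp add: power2_eq_square)
      then have "1 * (1/2) \<le> v * sqrt (1 - x\<^sup>2)"
        using elim by (intro mult_mono) auto
      then show "1 - exp (- \<mu>) \<le> ?f x"
        using assms by (simp add: mult.assoc)
    qed auto
    also have "\<dots> \<le> integral {0..1} ?f"
      using nonneg by (intro integral_subset_le int) auto
    finally show ?case
      using elim by (simp add: void_exponent_def)
  qed
qed

text \<open>The negative of the void probability is a primitive of the density, and it tends to 0
  because the exponent grows without bound.\<close>

lemma nn_integral_f_V0_atLeast:
  assumes "\<mu> > 0" "lam > 0" "a \<ge> 0"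
  shows "(\<integral>\<^sup>+v. ennreal (f_V0 lam \<mu> v) * indicator {a..} v \<partial>lborel)
    = ennreal (exp (- 2 * pi * lam * void_exponent \<mu> a))"
proof -
  let ?f = "\<lambda>v. 2 * pi * lam * void_exponent_deriv \<mu> v * exp (- 2 * pi * lam * void_exponent \<mu> v)"
  have [measurable]: "void_exponent_deriv \<mu> \<in> borel_measurable borel"
    "void_exponent \<mu> \<in> borel_measurable borel"
    using has_real_derivative_void_exponent
    by (auto intro!: borel_measurable_continuous_onI continuous_on_void_exponent_deriv
        DERIV_continuous_on)
  have "(\<integral>\<^sup>+v. ennreal (f_V0 lam \<mu> v) * indicator {a..} v \<partial>lborel)
      = (\<integral>\<^sup>+v. ennreal (?f v) * indicator {a..} v \<partial>lborel)"
    using assms by (intro nn_integral_cong) (auto simp: f_V0_eq indicator_def)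
  also have "\<dots> = ennreal (0 - (- exp (- 2 * pi * lam * void_exponent \<mu> a)))"
  proof (rule nn_integral_FTC_atLeast)
    show "((\<lambda>v. - exp (- 2 * pi * lam * void_exponent \<mu> v)) has_real_derivative ?f v) (at v)" for v
      by (auto intro!: derivative_eq_intros has_real_derivative_void_exponent)
    show "0 \<le> ?f v" if "a \<le> v" for v
      using that assms by (simp add: void_exponent_deriv_nonneg)
    have "((\<lambda>v. exp (- (2 * pi * lam * void_exponent \<mu> v))) \<longlongrightarrow> 0) at_top"
      using assms
      by (intro filterlim_compose[OF exp_at_bot] filterlim_compose[OF filterlim_uminus_at_bot_at_top]
          filterlim_tendsto_pos_mult_at_top[OF tendsto_const] filterlim_void_exponent) auto
    then show "((\<lambda>v. - exp (- 2 * pi * lam * void_exponent \<mu> v)) \<longlongrightarrow> 0) at_top"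
      using tendsto_minus by fastforce
  qed measurable
  finally show ?thesis by simp
qed

section \<open>The probability generating functional of a Poisson process\<close>

lemma space_config_space:
  "space (config_space S) = {A. A \<subseteq> S \<and> (\<forall>B. bounded B \<longrightarrow> finite (A \<inter> B))}"
  unfolding config_space_def Let_def by (rule space_measure_of) auto

lemma measurable_card_config_space:
  assumes "B \<in> sets borel" "bounded B"
  shows "(\<lambda>A. card (A \<inter> B)) \<in> measurable (config_space S) (count_space UNIV)"
proof (subst measurable_count_space_eq2_countable, safe)
  fix n
  let ?C = "{A. A \<subseteq> S \<and> (\<forall>B. bounded B \<longrightarrow> finite (A \<inter> B))}"
  have "(\<lambda>A. card (A \<inter> B)) -` {n} \<inter> space (config_space S) = {A \<in> ?C. card (A \<inter> B) = n}"
    by (auto simp: space_config_space)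
  also have "\<dots> \<in> sets (config_space S)"
    unfolding config_space_def Let_def using assms by (subst sets_measure_of) auto
  finally show "(\<lambda>A. card (A \<inter> B)) -` {n} \<inter> space (config_space S) \<in> sets (config_space S)" .
qed auto

lemma finite_config_Int:
  assumes "X \<in> measurable M (config_space S)" "\<omega> \<in> space M" "bounded B"
  shows "finite (X \<omega> \<inter> B)"
  using measurable_space[OF assms(1,2)] assms(3) by (simp add: space_config_space)

lemma (in prob_space) PPP_card_measurable:
  assumes "homogeneous_PPP lam S X" "B \<in> sets borel" "bounded B"
  shows "(\<lambda>\<omega>. card (X \<omega> \<inter> B)) \<in> measurable M (count_space UNIV)"
  using assms measurable_compose[OF _ measurable_card_config_space]
  by (auto simp: homogeneous_PPP_def)

text \<open>The generating function of a Poisson law, by summing the exponential series of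
  \<open>c * m\<close>. The value \<open>c = 0\<close> is included through \<open>0 ^ 0 = 1\<close>;
  it occurs when \<open>h\<close> below takes the value 0.\<close>

lemma (in prob_space) expectation_power_poisson:
  fixes K :: "'a \<Rightarrow> nat"
  assumes [measurable]: "K \<in> measurable M (count_space UNIV)"
    and K: "\<And>k. prob {\<omega> \<in> space M. K \<omega> = k} = m ^ k / fact k * exp (- m)"
    and c: "0 \<le> c"
  shows "expectation (\<lambda>\<omega>. c ^ K \<omega>) = exp (- m * (1 - c))"
proof -
  let ?p = "\<lambda>k. c ^ k * prob {\<omega> \<in> space M. K \<omega> = k}"
  have "(\<lambda>k. (c * m) ^ k /\<^sub>R fact k * exp (- m)) sums (exp (c * m) * exp (- m))"
    by (intro sums_mult2 exp_converges)
  moreover have "?p k = (c * m) ^ k /\<^sub>R fact k * exp (- m)" for k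
    unfolding K by (simp add: power_mult_distrib field_simps)
  moreover have "exp (c * m) * exp (- m) = exp (- m * (1 - c))"
    by (simp add: algebra_simps flip: exp_add)
  ultimately have sums: "?p sums exp (- m * (1 - c))"
    by simp
  have "(\<integral>\<^sup>+\<omega>. ennreal (c ^ K \<omega>) \<partial>M)
      = (\<integral>\<^sup>+\<omega>. (\<Sum>k. ennreal (c ^ k) * indicator {\<omega> \<in> space M. K \<omega> = k} \<omega>) \<partial>M)"
  proof (rule nn_integral_cong)
    fix \<omega> assume "\<omega> \<in> space M"
    then have "(\<Sum>k. ennreal (c ^ k) * indicator {\<omega> \<in> space M. K \<omega> = k} \<omega>)
        = (\<Sum>k\<in>{K \<omega>}. ennreal (c ^ k) * indicator {\<omega> \<in> space M. K \<omega> = k} \<omega>)"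
      by (intro suminf_finite) auto
    with \<open>\<omega> \<in> space M\<close> show "ennreal (c ^ K \<omega>)
        = (\<Sum>k. ennreal (c ^ k) * indicator {\<omega> \<in> space M. K \<omega> = k} \<omega>)"
      by simp
  qed
  also have "\<dots> = (\<Sum>k. ennreal (c ^ k) * emeasure M {\<omega> \<in> space M. K \<omega> = k})"
    by (subst nn_integral_suminf) (simp_all add: nn_integral_cmult_indicator)
  also have "\<dots> = (\<Sum>k. ennreal (?p k))"
    using c by (simp add: emeasure_eq_measure ennreal_mult)
  also have "\<dots> = ennreal (exp (- m * (1 - c)))"
    using c sums by (subst suminf_ennreal2) (auto simp: sums_iff)
  finally show ?thesis
    using c by (subst integral_eq_nn_integral) auto
qed

text \<open>Grouping the points of \<open>B\<close> by the value of \<open>h\<close> turns the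
  product into powers of that value, with the counts on the level sets as exponents. The level sets
  are disjoint and bounded, so the counts are independent Poisson variables and the expectation
  factorises.\<close>

lemma (in prob_space) PPP_pgfl_simple:
  fixes h :: "'b::euclidean_space \<Rightarrow> real"
  assumes X: "homogeneous_PPP lam S X"
    and B: "B \<in> sets borel" "bounded B" "B \<subseteq> S"
    and h: "simple_function borel h" "\<And>x. 0 \<le> h x" "\<And>x. h x \<le> 1"
  shows "(\<lambda>\<omega>. \<Prod>x\<in>X \<omega> \<inter> B. h x) \<in> borel_measurable M"
    and "expectation (\<lambda>\<omega>. \<Prod>x\<in>X \<omega> \<inter> B. h x) = exp (- lam * (LBINT x:B. 1 - h x))"
proof -
  have h_borel [measurable]: "h \<in> borel_measurable borel"
    using h(1) by (rule borel_measurable_simple_function)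
  have fin: "finite (range h)"
    using simple_functionD(1)[OF h(1)] by simp
  \<comment> \<open>The values of \<open>h\<close> are numbered because
    \<open>homogeneous_PPP\<close> states independence for families indexed by
    \<open>{..<n}\<close>.\<close>
  define n where "n = card (range h)"
  obtain c where c: "bij_betw c {..<n} (range h)"
    using ex_bij_betw_nat_finite[OF fin] unfolding n_def lessThan_atLeast0 by blast
  define D where "D i = h -` {c i} \<inter> B" for i
  have D: "D i \<in> sets borel" "bounded (D i)" "D i \<subseteq> S" for i
  proof -
    show "D i \<in> sets borel"
      using B(1) h_borel by (auto simp: D_def intro: measurable_sets_borel)
    show "bounded (D i)" "D i \<subseteq> S"
      using B by (auto simp: D_def intro: bounded_subset)
  qed
  note [measurable] = PPP_card_measurable[OF X D(1,2)]
  have disj: "disjoint_family_on D {..<n}"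
    using c by (auto simp: disjoint_family_on_def D_def bij_betw_def inj_on_def)
  have c01: "0 \<le> c i" "c i \<le> 1" if "i < n" for i
  proof -
    have "c i \<in> range h" using bij_betwE[OF c] that by blast
    then show "0 \<le> c i" "c i \<le> 1" using h by auto
  qed
  have prod_eq: "(\<Prod>x\<in>X \<omega> \<inter> B. h x) = (\<Prod>i<n. c i ^ card (X \<omega> \<inter> D i))" if "\<omega> \<in> space M" for \<omega>
  proof -
    have "finite (X \<omega> \<inter> B)"
      using X that B(2) by (intro finite_config_Int) (auto simp: homogeneous_PPP_def)
    then have "(\<Prod>x\<in>X \<omega> \<inter> B. h x) = (\<Prod>y\<in>range h. \<Prod>x | x \<in> X \<omega> \<inter> B \<and> h x = y. h x)"
      using fin by (intro prod.group[symmetric]) auto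
    also have "\<dots> = (\<Prod>y\<in>range h. y ^ card {x \<in> X \<omega> \<inter> B. h x = y})"
      by (intro prod.cong refl) simp
    also have "\<dots> = (\<Prod>i<n. c i ^ card {x \<in> X \<omega> \<inter> B. h x = c i})"
      by (rule prod.reindex_bij_betw[OF c, symmetric])
    also have "\<dots> = (\<Prod>i<n. c i ^ card (X \<omega> \<inter> D i))"
      by (intro prod.cong arg_cong[where f="\<lambda>A. _ ^ card A"]) (auto simp: D_def)
    finally show ?thesis .
  qed
  show "(\<lambda>\<omega>. \<Prod>x\<in>X \<omega> \<inter> B. h x) \<in> borel_measurable M"
    by (subst measurable_cong[OF prod_eq]) auto
  have "indep_vars (\<lambda>_. count_space UNIV) (\<lambda>i \<omega>. card (X \<omega> \<inter> D i)) {..<n}"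
    using X D disj by (auto simp: homogeneous_PPP_def)
  then have indep: "indep_vars (\<lambda>_. borel) (\<lambda>i \<omega>. c i ^ card (X \<omega> \<inter> D i)) {..<n}"
    by (rule indep_vars_compose2) simp
  have "expectation (\<lambda>\<omega>. \<Prod>x\<in>X \<omega> \<inter> B. h x) = expectation (\<lambda>\<omega>. \<Prod>i<n. c i ^ card (X \<omega> \<inter> D i))"
    by (intro Bochner_Integration.integral_cong refl prod_eq)
  also have "\<dots> = (\<Prod>i<n. expectation (\<lambda>\<omega>. c i ^ card (X \<omega> \<inter> D i)))"
  proof (rule indep_vars_lebesgue_integral[OF _ indep])
    fix i assume "i \<in> {..<n}"
    then show "integrable M (\<lambda>\<omega>. c i ^ card (X \<omega> \<inter> D i))"
      by (intro integrable_const_bound[where B=1]) (auto simp: c01 power_le_one)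
  qed simp
  also have "\<dots> = (\<Prod>i<n. exp (- (lam * measure lborel (D i)) * (1 - c i)))"
    using X D c01 by (intro prod.cong expectation_power_poisson) (auto simp: homogeneous_PPP_def)
  also have "\<dots> = exp (- lam * (\<Sum>i<n. (1 - c i) * measure lborel (D i)))"
    by (simp add: sum_distrib_left sum_negf ac_simps flip: exp_sum)
  also have "(\<Sum>i<n. (1 - c i) * measure lborel (D i)) = (LBINT x:B. 1 - h x)"
  proof -
    have "(LBINT x:B. 1 - h x) = (LBINT x. (\<Sum>i<n. (1 - c i) * indicator (D i) x))"
      unfolding set_lebesgue_integral_def
    proof (rule Bochner_Integration.integral_cong[OF refl])
      fix x
      obtain j where j: "j < n" "h x = c j"
        using bij_betw_imp_surj_on[OF c] by (metis imageE lessThan_iff rangeI)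
      have "(\<Sum>i<n. (1 - c i) * indicator (D i) x) = (\<Sum>i\<in>{j}. (1 - c i) * indicator (D i) x)"
        using j c by (intro sum.mono_neutral_right)
          (auto simp: D_def bij_betw_def inj_on_def indicator_def)
      then show "indicator B x *\<^sub>R (1 - h x) = (\<Sum>i<n. (1 - c i) * indicator (D i) x)"
        using j by (simp add: D_def indicator_def)
    qed
    also have "\<dots> = (\<Sum>i<n. (1 - c i) * measure lborel (D i))"
      using D(1) emeasure_bounded_finite[OF D(2)]
      by (subst Bochner_Integration.integral_sum) (auto intro!: integrable_mult_right integrable_real_indicator)
    finally show ?thesis by simp
  qed
  finally show "expectation (\<lambda>\<omega>. \<Prod>x\<in>X \<omega> \<inter> B. h x) = exp (- lam * (LBINT x:B. 1 - h x))" .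
qed

text \<open>Pointwise approximation by simple functions with values in \<open>[0, 1]\<close>. Both
  sides pass to the limit by dominated convergence: the products are bounded by 1, and the
  integrands by the indicator of \<open>B\<close>, which has finite measure.\<close>

lemma (in prob_space) PPP_pgfl:
  fixes h :: "'b::euclidean_space \<Rightarrow> real"
  assumes X: "homogeneous_PPP lam S X"
    and B: "B \<in> sets borel" "bounded B" "B \<subseteq> S"
    and h [measurable]: "h \<in> borel_measurable borel" and h01: "\<And>x. 0 \<le> h x" "\<And>x. h x \<le> 1"
  shows PPP_prod_measurable: "(\<lambda>\<omega>. \<Prod>x\<in>X \<omega> \<inter> B. h x) \<in> borel_measurable M"
    and PPP_expectation_prod:
      "expectation (\<lambda>\<omega>. \<Prod>x\<in>X \<omega> \<inter> B. h x) = exp (- lam * (LBINT x:B. 1 - h x))"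
proof -
  obtain F where F: "\<And>i. simple_function borel (F i)" "\<And>x. (\<lambda>i. F i x) \<longlonglongrightarrow> h x"
    using borel_measurable_implies_sequence_metric[OF h, of 0] by auto
  \<comment> \<open>Clipping keeps the approximants simple, puts them in \<open>[0, 1]\<close> as
    the simple case requires, and leaves the limit unchanged since \<open>h\<close> already lies
    there.\<close>
  define U where "U i x = max 0 (min 1 (F i x))" for i x
  have U01: "0 \<le> U i x" "U i x \<le> 1" for i x
    by (auto simp: U_def)
  have U_simple: "simple_function borel (U i)" for i
    unfolding U_def by (rule simple_function_compose1[OF F(1)])
  have [measurable]: "U i \<in> borel_measurable borel" for i
    using U_simple by (rule borel_measurable_simple_function)
  have U_lim: "(\<lambda>i. U i x) \<longlonglongrightarrow> h x" for x
  proof -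
    have "(\<lambda>i. U i x) \<longlonglongrightarrow> max 0 (min 1 (h x))"
      unfolding U_def by (intro tendsto_intros F)
    then show ?thesis using h01[of x] by simp
  qed
  note U = PPP_pgfl_simple[OF X B U_simple U01]
  have lim: "(\<lambda>i. \<Prod>x\<in>X \<omega> \<inter> B. U i x) \<longlonglongrightarrow> (\<Prod>x\<in>X \<omega> \<inter> B. h x)" for \<omega>
    by (intro tendsto_prod U_lim)
  show meas: "(\<lambda>\<omega>. \<Prod>x\<in>X \<omega> \<inter> B. h x) \<in> borel_measurable M"
    by (rule borel_measurable_LIMSEQ_real[OF lim U(1)])
  have "(\<lambda>i. expectation (\<lambda>\<omega>. \<Prod>x\<in>X \<omega> \<inter> B. U i x)) \<longlonglongrightarrow> expectation (\<lambda>\<omega>. \<Prod>x\<in>X \<omega> \<inter> B. h x)"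
    by (rule integral_dominated_convergence[where w="\<lambda>_. 1"])
      (auto simp: meas U(1) lim abs_prod U01 intro!: prod_le_1)
  moreover have "(\<lambda>i. LBINT x:B. 1 - U i x) \<longlonglongrightarrow> (LBINT x:B. 1 - h x)"
    unfolding set_lebesgue_integral_def
  proof (rule integral_dominated_convergence[where w="indicator B"])
    show "integrable lborel (indicator B :: 'b \<Rightarrow> real)"
      using B(1) emeasure_bounded_finite[OF B(2)] by (auto intro!: integrable_real_indicator)
    show "AE x in lborel. (\<lambda>i. indicator B x *\<^sub>R (1 - U i x)) \<longlonglongrightarrow> indicator B x *\<^sub>R (1 - h x)"
      by (intro AE_I2 tendsto_intros U_lim)
  qed (use B(1) U01 in \<open>auto simp: indicator_def\<close>)
  then have "(\<lambda>i. exp (- lam * (LBINT x:B. 1 - U i x))) \<longlonglongrightarrow> exp (- lam * (LBINT x:B. 1 - h x))"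
    by (intro tendsto_intros)
  ultimately show "expectation (\<lambda>\<omega>. \<Prod>x\<in>X \<omega> \<inter> B. h x) = exp (- lam * (LBINT x:B. 1 - h x))"
    unfolding U(2) by (rule LIMSEQ_unique)
qed

section \<open>Void probabilities of the node process\<close>

lemma Int_ball_0_eq_empty_iff:
  "A \<inter> ball 0 r = {} \<longleftrightarrow> (\<forall>x\<in>A. \<not> norm x < r)"
  by (simp add: disjoint_iff Ball_def del: split_paired_All)

text \<open>Lines are measured by \<open>borel\<close> on the product type; continuity of
  \<open>snd\<close> makes the distance coordinate measurable there.\<close>

lemma borel_measurable_snd_compose [measurable (raw)]:
  fixes f :: "'a \<Rightarrow> 'b::topological_space \<times> 'c::topological_space"
  assumes "f \<in> borel_measurable M"
  shows "(\<lambda>x. snd (f x)) \<in> borel_measurable M"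
  by (rule measurable_compose[OF assms])
    (intro borel_measurable_continuous_onI continuous_on_snd continuous_on_id)

text \<open>The sigma-algebra on configurations controls counts in fixed sets, but the radius is
  random. An open ball is the union of the balls of smaller rational radius, so countably many fixed
  counts suffice; local finiteness makes count 0 equivalent to emptiness.\<close>

lemma pred_config_Int_ball [measurable (raw)]:
  fixes X :: "'a \<Rightarrow> 'b::euclidean_space set"
  assumes X: "X \<in> measurable M (config_space S)" and r [measurable]: "r \<in> borel_measurable M"
  shows "Measurable.pred M (\<lambda>\<omega>. X \<omega> \<inter> ball 0 (r \<omega>) = {})"
proof -
  define K where "K q \<omega> = card (X \<omega> \<inter> ball 0 q)" for q \<omega>
  have [measurable]: "K q \<in> measurable M (count_space UNIV)" for q
    unfolding K_def by (rule measurable_compose[OF X measurable_card_config_space]) auto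
  have eq: "X \<omega> \<inter> ball 0 (r \<omega>) = {} \<longleftrightarrow> (\<forall>q::rat. of_rat q < r \<omega> \<longrightarrow> K (of_rat q) \<omega> = 0)"
    if "\<omega> \<in> space M" for \<omega>
  proof -
    have "K q \<omega> = 0 \<longleftrightarrow> X \<omega> \<inter> ball 0 q = {}" for q
      unfolding K_def using finite_config_Int[OF X that] by simp
    then show ?thesis
    proof (intro iffI, goal_cases)
      case 1
      then show ?case by (auto simp: Int_ball_0_eq_empty_iff)
    next
      case 2
      show ?case
      proof (rule ccontr)
        assume "X \<omega> \<inter> ball 0 (r \<omega>) \<noteq> {}"
        then obtain x where x: "x \<in> X \<omega>" "norm x < r \<omega>" by auto
        then obtain q where "norm x < of_rat q" "of_rat q < r \<omega>"
          using of_rat_dense by blast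
        with 2 x show False by (auto simp: Int_ball_0_eq_empty_iff)
      qed
    qed
  qed
  have "Measurable.pred M (\<lambda>\<omega>. c < r \<omega> \<longrightarrow> K c \<omega> = 0)" for c
    by measurable
  then have "Measurable.pred M (\<lambda>\<omega>. \<forall>q::rat. of_rat q < r \<omega> \<longrightarrow> K (of_rat q) \<omega> = 0)"
    by (rule pred_intros_countable(1))
  then show ?thesis
    by (simp only: measurable_cong[OF eq])
qed

text \<open>The infimum is a greatest lower bound, so a weak inequality for the distance corresponds
  to an open ball, whether or not the infimum is attained.\<close>

lemma infdist_ge_iff:
  assumes "A \<noteq> {}"
  shows "r \<le> infdist x A \<longleftrightarrow> A \<inter> ball x r = {}"
proof -
  have "r \<le> infdist x A \<longleftrightarrow> (\<forall>a\<in>A. r \<le> dist x a)"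
    using assms by (simp add: infdist_notempty le_cINF_iff)
  then show ?thesis by (auto simp: disjoint_iff not_less)
qed

text \<open>Expresses emptiness by countably many void events, which makes it measurable and lets
  its probability be estimated.\<close>

lemma eq_empty_iff_Int_ball:
  fixes A :: "'b::metric_space set"
  shows "A = {} \<longleftrightarrow> (\<forall>n::nat. A \<inter> ball x (real n) = {})"
proof -
  have "\<exists>n::nat. a \<in> ball x (real n)" for a
    using reals_Archimedean2[of "dist x a"] by auto
  then show ?thesis by (auto simp: disjoint_iff)
qed

lemma borel_measurable_infdist_pred:
  fixes A :: "'a \<Rightarrow> 'b::metric_space set"
  assumes [measurable]: "\<And>r. Measurable.pred M (\<lambda>\<omega>. A \<omega> \<inter> ball x r = {})"
  shows "(\<lambda>\<omega>. infdist x (A \<omega>)) \<in> borel_measurable M"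
proof (subst borel_measurable_iff_ge, intro allI)
  fix r
  \<comment> \<open>The empty set is treated apart, because there \<open>infdist\<close> takes the
    default value 0 although every ball is void.\<close>
  have "r \<le> infdist x (A \<omega>) \<longleftrightarrow> (if \<forall>n::nat. A \<omega> \<inter> ball x (real n) = {} then r \<le> 0
      else A \<omega> \<inter> ball x r = {})" for \<omega>
    using eq_empty_iff_Int_ball[of "A \<omega>" x] infdist_ge_iff[of "A \<omega>" r x]
    by (auto simp: infdist_def)
  then show "{\<omega> \<in> space M. r \<le> infdist x (A \<omega>)} \<in> sets M"
    by simp
qed

lemma norm_line_point: "norm (line_point l t) = sqrt ((snd l)\<^sup>2 + t\<^sup>2)"
proof (cases l)
  case (Pair \<theta> \<rho>)
  have "(\<rho> * cos \<theta> - t * sin \<theta>)\<^sup>2 + (\<rho> * sin \<theta> + t * cos \<theta>)\<^sup>2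
      = (\<rho>\<^sup>2 + t\<^sup>2) * ((sin \<theta>)\<^sup>2 + (cos \<theta>)\<^sup>2)"
    by algebra
  then show ?thesis
    by (simp add: Pair line_point_def norm_Pair)
qed

text \<open>For \<open>r\<^sup>2 < (snd l)\<^sup>2\<close> the square root is negative and both sides hold.\<close>

lemma line_point_Int_ball:
  assumes "r \<ge> 0"
  shows "line_point l ` A \<inter> ball 0 r = {} \<longleftrightarrow> A \<inter> ball 0 (sqrt (r\<^sup>2 - (snd l)\<^sup>2)) = {}"
proof -
  have "norm (line_point l t) < r \<longleftrightarrow> \<bar>t\<bar> < sqrt (r\<^sup>2 - (snd l)\<^sup>2)" for t
  proof -
    have "norm (line_point l t) < r \<longleftrightarrow> (snd l)\<^sup>2 + t\<^sup>2 < r\<^sup>2"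
      unfolding norm_line_point using assms real_sqrt_less_iff[of _ "r\<^sup>2"] by simp
    also have "\<dots> \<longleftrightarrow> sqrt (t\<^sup>2) < sqrt (r\<^sup>2 - (snd l)\<^sup>2)"
      unfolding real_sqrt_less_iff by auto
    finally show ?thesis by simp
  qed
  then show ?thesis by (simp add: Int_ball_0_eq_empty_iff)
qed

lemma typical_line_nodes_Int_ball:
  "typical_line_nodes \<theta>\<^sub>0 N \<omega> \<inter> ball 0 r = {} \<longleftrightarrow> N None \<omega> \<inter> ball 0 r = {}"
  using line_point_Int_ball[of r "(\<theta>\<^sub>0, 0)" "N None \<omega>"]
  by (cases "r \<ge> 0") (simp_all add: typical_line_nodes_def ball_empty)

text \<open>A negative radius must be clipped before it is squared: the ball is empty, but
  \<open>r\<^sup>2\<close> would produce a genuine interval on each nearby line.\<close>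

lemma other_line_nodes_Int_ball:
  "other_line_nodes L N \<omega> \<inter> ball 0 r = {} \<longleftrightarrow>
    (\<forall>i. N (Some i) \<omega> \<inter> ball 0 (sqrt ((max 0 r)\<^sup>2 - (snd (L i \<omega>))\<^sup>2)) = {})"
proof -
  have "ball 0 r = (ball 0 (max 0 r) :: (real \<times> real) set)"
    by (auto simp: max_def)
  then have "other_line_nodes L N \<omega> \<inter> ball 0 r = {} \<longleftrightarrow>
      (\<forall>i. line_point (L i \<omega>) ` N (Some i) \<omega> \<inter> ball 0 (max 0 r) = {})"
    by (auto simp: other_line_nodes_def)
  then show ?thesis by (simp add: line_point_Int_ball)
qed

lemma all_nodes_Int_ball:
  "all_nodes \<theta>\<^sub>0 L N \<omega> \<inter> ball 0 r = {} \<longleftrightarrow>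
    typical_line_nodes \<theta>\<^sub>0 N \<omega> \<inter> ball 0 r = {} \<and> other_line_nodes L N \<omega> \<inter> ball 0 r = {}"
  by (auto simp: all_nodes_def)

text \<open>Independence on generated sigma-algebras fixes the joint law on rectangles, hence makes
  it the product measure to which Fubini applies. Used for lines against nodes and again for the two
  distances.\<close>

lemma (in prob_space) distr_Pair_indep_set:
  assumes [measurable]: "X \<in> measurable M S" "Y \<in> measurable M T"
    and indep: "indep_set (sets (vimage_algebra (space M) X S)) (sets (vimage_algebra (space M) Y T))"
  shows "distr M S X \<Otimes>\<^sub>M distr M T Y = distr M (S \<Otimes>\<^sub>M T) (\<lambda>\<omega>. (X \<omega>, Y \<omega>))"
proof (rule pair_measure_eqI)
  interpret X: prob_space "distr M S X" by (rule prob_space_distr) simp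
  interpret Y: prob_space "distr M T Y" by (rule prob_space_distr) simp
  show "sigma_finite_measure (distr M S X)" "sigma_finite_measure (distr M T Y)"
    by unfold_locales
  fix A B assume AB: "A \<in> sets (distr M S X)" "B \<in> sets (distr M T Y)"
  then have [measurable]: "A \<in> sets S" "B \<in> sets T" by auto
  have "prob ((X -` A \<inter> space M) \<inter> (Y -` B \<inter> space M))
      = prob (X -` A \<inter> space M) * prob (Y -` B \<inter> space M)"
    by (intro indep_setD[OF indep] in_vimage_algebra) simp_all
  moreover have "(\<lambda>\<omega>. (X \<omega>, Y \<omega>)) -` (A \<times> B) \<inter> space M = (X -` A \<inter> space M) \<inter> (Y -` B \<inter> space M)"
    by auto
  ultimately show "emeasure (distr M S X) A * emeasure (distr M T Y) B
      = emeasure (distr M (S \<Otimes>\<^sub>M T) (\<lambda>\<omega>. (X \<omega>, Y \<omega>))) (A \<times> B)"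
    by (simp add: emeasure_distr emeasure_eq_measure ennreal_mult)
qed simp

section \<open>Void probabilities given the lines, and their mean over the line process\<close>

context poisson_line_cox
begin

lemma nodes_measurable [measurable]: "N j \<in> measurable M (config_space UNIV)"
  using nodes_PPP[of j] by (simp add: homogeneous_PPP_def)

declare lines_measurable [measurable]

lemma pred_typical_line_nodes [measurable]:
  "Measurable.pred M (\<lambda>\<omega>. typical_line_nodes \<theta>\<^sub>0 N \<omega> \<inter> ball 0 r = {})"
  unfolding typical_line_nodes_Int_ball by measurable

lemma pred_other_line_nodes [measurable]:
  "Measurable.pred M (\<lambda>\<omega>. other_line_nodes L N \<omega> \<inter> ball 0 r = {})"
  unfolding other_line_nodes_Int_ball by measurable

lemma pred_all_nodes [measurable]:
  "Measurable.pred M (\<lambda>\<omega>. all_nodes \<theta>\<^sub>0 L N \<omega> \<inter> ball 0 r = {})"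
  unfolding all_nodes_Int_ball by measurable

lemma S0_dist_measurable [measurable]: "S0_dist \<theta>\<^sub>0 N \<in> borel_measurable M"
  unfolding S0_dist_def by (rule borel_measurable_infdist_pred) measurable

lemma V0_dist_measurable [measurable]: "V0_dist L N \<in> borel_measurable M"
  unfolding V0_dist_def by (rule borel_measurable_infdist_pred) measurable

lemma serving_dist_measurable [measurable]: "serving_dist \<theta>\<^sub>0 L N \<in> borel_measurable M"
  unfolding serving_dist_def by (rule borel_measurable_infdist_pred) measurable

text \<open>On the real line the ball is an interval of length \<open>2 * r\<close>, which is the
  origin of the factor 2; it is empty for negative \<open>r\<close>.\<close>

lemma prob_void_nodes:
  "prob {\<omega> \<in> space M. N j \<omega> \<inter> ball 0 r = {}} = exp (- 2 * lam\<^sub>v * max 0 r)"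
proof -
  have "{\<omega> \<in> space M. N j \<omega> \<inter> ball 0 r = {}} = {\<omega> \<in> space M. card (N j \<omega> \<inter> ball 0 r) = 0}"
    using finite_config_Int[OF nodes_measurable, of _ "ball 0 r"] by (intro Collect_cong conj_cong) simp_all
  also have "prob \<dots> = exp (- (lam\<^sub>v * measure lborel (ball 0 r :: real set)))"
    using nodes_PPP[of j] by (simp add: homogeneous_PPP_def)
  also have "measure lborel (ball 0 r :: real set) = 2 * max 0 r"
    by (cases "r \<ge> 0") (auto simp: ball_eq_greaterThanLessThan)
  finally show ?thesis by (simp add: ac_simps)
qed

lemma prob_void_nodes_finite:
  assumes "finite J"
  shows "prob {\<omega> \<in> space M. \<forall>j\<in>J. N j \<omega> \<inter> ball 0 (r j) = {}}
    = (\<Prod>j\<in>J. exp (- 2 * lam\<^sub>v * max 0 (r j)))"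
\<comment> \<open>The event is rewritten below as an intersection over \<open>J\<close>, which for
  empty \<open>J\<close> would be \<open>UNIV\<close> instead of \<open>space M\<close>.\<close>
proof (cases "J = {}")
  case True
  then show ?thesis by (simp add: prob_space)
next
  case False
  define Q where "Q j = {A \<in> space (config_space (UNIV :: real set)). A \<inter> ball 0 (r j) = {}}" for j
  have [measurable]: "Q j \<in> sets (config_space UNIV)" for j
    unfolding Q_def by measurable
  have vim: "N j -` Q j \<inter> space M = {\<omega> \<in> space M. N j \<omega> \<inter> ball 0 (r j) = {}}" for j
    using measurable_space[OF nodes_measurable] by (auto simp: Q_def)
  have "{\<omega> \<in> space M. \<forall>j\<in>J. N j \<omega> \<inter> ball 0 (r j) = {}} = (\<Inter>j\<in>J. N j -` Q j \<inter> space M)"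
    using False by (auto simp: vim)
  also have "prob \<dots> = (\<Prod>j\<in>J. prob (N j -` Q j \<inter> space M))"
    using assms False by (intro indep_varsD[OF nodes_indep]) auto
  finally show ?thesis by (simp add: vim prob_void_nodes)
qed

text \<open>The conditional probability that the line \<open>l\<close> has no node in the open ball
  of radius \<open>v\<close>: a line at distance below \<open>v\<close> cuts it in a chord of
  half-length \<open>sqrt (v\<^sup>2 - (snd l)\<^sup>2)\<close>. For a line farther away the root is
  negative and clipping gives the factor 1.\<close>

definition void_factor :: "real \<Rightarrow> real \<times> real \<Rightarrow> real" where
  "void_factor v l = exp (- 2 * lam\<^sub>v * max 0 (sqrt (v\<^sup>2 - (snd l)\<^sup>2)))"

lemma void_factor_bounds: "0 \<le> void_factor v l" "void_factor v l \<le> 1"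
  using intensity_nodes_pos by (auto simp: void_factor_def)

lemma void_factor_measurable [measurable]: "void_factor v \<in> borel_measurable borel"
  unfolding void_factor_def by (auto intro!: borel_measurable_continuous_onI continuous_intros)

text \<open>Conditioning on the lines by Fubini: once they are fixed, the radii are constants and
  the void formula for finitely many node processes applies, hence the restriction to the first
  \<open>n\<close> lines. The typical line contributes a factor that does not depend on
  them.\<close>

lemma prob_void_first_lines:
  "prob {\<omega> \<in> space M. N None \<omega> \<inter> ball 0 s = {} \<and>
      (\<forall>i<n. N (Some i) \<omega> \<inter> ball 0 (sqrt (v\<^sup>2 - (snd (L i \<omega>))\<^sup>2)) = {})}
    = expectation (\<lambda>\<omega>. exp (- 2 * lam\<^sub>v * max 0 s) * (\<Prod>i<n. void_factor v (L i \<omega>)))"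
proof -
  let ?P1 = "\<Pi>\<^sub>M i\<in>(UNIV::nat set). (borel :: (real \<times> real) measure)"
  let ?P2 = "\<Pi>\<^sub>M j\<in>(UNIV::nat option set). (config_space UNIV :: real set measure)"
  let ?L = "\<lambda>\<omega> i. L i \<omega>" and ?N = "\<lambda>\<omega> j. N j \<omega>"
  let ?f = "\<lambda>l. exp (- 2 * lam\<^sub>v * max 0 s) * (\<Prod>i<n. void_factor v (l i))"
  have mN [measurable]: "?N \<in> measurable M ?P2" and mL [measurable]: "?L \<in> measurable M ?P1"
    by (auto intro!: measurable_PiM_single' simp: measurable_space[OF nodes_measurable])
  have joint: "distr M (?P1 \<Otimes>\<^sub>M ?P2) (\<lambda>\<omega>. (?L \<omega>, ?N \<omega>)) = distr M ?P1 ?L \<Otimes>\<^sub>M distr M ?P2 ?N"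
    by (rule distr_Pair_indep_set[symmetric]) (use nodes_indep_lines in simp_all)
  define E where "E = {z \<in> space (?P1 \<Otimes>\<^sub>M ?P2). snd z None \<inter> ball 0 s = {} \<and>
      (\<forall>i<n. snd z (Some i) \<inter> ball 0 (sqrt (v\<^sup>2 - (snd (fst z i))\<^sup>2)) = {})}"
  have E [measurable]: "E \<in> sets (?P1 \<Otimes>\<^sub>M ?P2)"
    unfolding E_def by measurable
  interpret D2: prob_space "distr M ?P2 ?N"
    by (rule prob_space_distr) measurable
  have inner: "emeasure (distr M ?P2 ?N) (Pair l -` E) = ennreal (?f l)" if "l \<in> space ?P1" for l
  proof -
    \<comment> \<open>One radius per node process: \<open>s\<close> on the typical line, the
      half-chord on the line with index \<open>i\<close>.\<close>
    let ?r = "case_option s (\<lambda>i. sqrt (v\<^sup>2 - (snd (l i))\<^sup>2))"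
    let ?J = "insert None (Some ` {..<n})"
    have "emeasure (distr M ?P2 ?N) (Pair l -` E) = emeasure M (?N -` (Pair l -` E) \<inter> space M)"
      by (rule emeasure_distr[OF mN sets_Pair1[OF E]])
    also have "?N -` (Pair l -` E) \<inter> space M = {\<omega> \<in> space M. \<forall>j\<in>?J. N j \<omega> \<inter> ball 0 (?r j) = {}}"
      using that measurable_space[OF mN] by (auto simp: E_def space_pair_measure)
    also have "emeasure M \<dots> = ennreal (\<Prod>j\<in>?J. exp (- 2 * lam\<^sub>v * max 0 (?r j)))"
      by (subst emeasure_eq_measure, subst prob_void_nodes_finite) auto
    also have "(\<Prod>j\<in>?J. exp (- 2 * lam\<^sub>v * max 0 (?r j))) = ?f l"
      by (subst prod.insert) (auto simp: prod.reindex void_factor_def)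
    finally show ?thesis .
  qed
  have "{\<omega> \<in> space M. N None \<omega> \<inter> ball 0 s = {} \<and>
      (\<forall>i<n. N (Some i) \<omega> \<inter> ball 0 (sqrt (v\<^sup>2 - (snd (L i \<omega>))\<^sup>2)) = {})}
    = (\<lambda>\<omega>. (?L \<omega>, ?N \<omega>)) -` E \<inter> space M"
    using measurable_space[OF mN] measurable_space[OF mL] by (auto simp: E_def space_pair_measure)
  then have "emeasure M {\<omega> \<in> space M. N None \<omega> \<inter> ball 0 s = {} \<and>
      (\<forall>i<n. N (Some i) \<omega> \<inter> ball 0 (sqrt (v\<^sup>2 - (snd (L i \<omega>))\<^sup>2)) = {})}
    = emeasure (distr M (?P1 \<Otimes>\<^sub>M ?P2) (\<lambda>\<omega>. (?L \<omega>, ?N \<omega>))) E"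
    by (simp add: emeasure_distr)
  also have "\<dots> = (\<integral>\<^sup>+l. emeasure (distr M ?P2 ?N) (Pair l -` E) \<partial>distr M ?P1 ?L)"
    unfolding joint by (rule D2.emeasure_pair_measure_alt) simp
  also have "\<dots> = (\<integral>\<^sup>+l. ennreal (?f l) \<partial>distr M ?P1 ?L)"
    by (intro nn_integral_cong inner) simp
  also have "\<dots> = (\<integral>\<^sup>+\<omega>. ennreal (?f (?L \<omega>)) \<partial>M)"
    by (rule nn_integral_distr) measurable
  also have "\<dots> = ennreal (expectation (\<lambda>\<omega>. ?f (?L \<omega>)))"
  proof (rule nn_integral_eq_integral)
    show "integrable M (\<lambda>\<omega>. ?f (?L \<omega>))"
      using intensity_nodes_pos
      by (intro integrable_const_bound[where B=1])
        (auto simp: abs_mult abs_prod void_factor_bounds intro!: mult_le_one prod_le_1 prod_nonneg)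
  qed (auto intro!: AE_I2 mult_nonneg_nonneg prod_nonneg void_factor_bounds)
  finally show ?thesis
    by (subst (asm) emeasure_eq_measure, subst (asm) ennreal_inj)
      (auto intro!: mult_nonneg_nonneg prod_nonneg void_factor_bounds integral_nonneg_AE AE_I2)
qed

end

lemma line_strip_borel_bounded:
  "{0..<2*pi} \<times> {0..v} \<in> sets (borel :: (real \<times> real) measure)"
  "bounded ({0..<2*pi} \<times> {0..v :: real})"
  by (auto intro!: borel_Times
      bounded_subset[OF bounded_Times[OF bounded_closed_interval[of 0 "2*pi"] bounded_closed_interval[of 0 v]]])

lemma image_Collect_mem: "f ` {i. f i \<in> B} = range f \<inter> B"
  by auto

context poisson_line_cox
begin

text \<open>The factor does not depend on the angle, so integrating over the angle gives
  \<open>2 * pi\<close>. On the strip the root is nonnegative, so the clipping in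
  \<open>void_factor\<close> disappears.\<close>

lemma LBINT_void_factor:
  assumes "v \<ge> 0"
  shows "(LBINT l:{0..<2*pi} \<times> {0..v}. 1 - void_factor v l) = 2 * pi * void_exponent lam\<^sub>v v"
proof -
  let ?B = "{0..<2*pi} \<times> {0..v}"
  let ?f = "\<lambda>l. indicator ?B l *\<^sub>R (1 - void_factor v l)"
  note B = line_strip_borel_bounded[of v]
  have "integrable lborel ?f"
    using B emeasure_bounded_finite[OF B(2)] void_factor_bounds
    by (intro integrableI_bounded_set_indicator[where B=1]) auto
  then have int: "integrable (lborel \<Otimes>\<^sub>M lborel) ?f"
    by (simp add: lborel_prod)
  have inner: "(LBINT \<rho>. ?f (\<theta>, \<rho>)) = indicator {0..<2*pi} \<theta> * void_exponent lam\<^sub>v v" for \<theta>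
  proof -
    have "(LBINT \<rho>. ?f (\<theta>, \<rho>))
        = (LBINT \<rho>. indicator {0..<2*pi} \<theta> *
            (indicator {0..v} \<rho> *\<^sub>R (1 - exp (- 2 * lam\<^sub>v * sqrt (v\<^sup>2 - \<rho>\<^sup>2)))))"
      by (intro Bochner_Integration.integral_cong refl)
        (auto simp: void_factor_def indicator_def max_def power_mono)
    then show ?thesis
      using assms by (simp add: void_exponent_eq_LBINT set_lebesgue_integral_def)
  qed
  have "(LBINT l:?B. 1 - void_factor v l) = (LBINT \<theta>. LBINT \<rho>. ?f (\<theta>, \<rho>))"
    unfolding set_lebesgue_integral_def lborel_pair.integral_fst'[OF int] by (simp add: lborel_prod)
  also have "\<dots> = (LBINT \<theta>. indicator {0..<2*pi} \<theta> * void_exponent lam\<^sub>v v)"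
    by (simp only: inner)
  finally show ?thesis by simp
qed

text \<open>By local finiteness only finitely many lines lie in the strip, and every other line has
  factor 1, so the partial products are eventually constant.\<close>

lemma AE_void_factor_prod:
  assumes "v \<ge> 0"
  shows "AE \<omega> in M. (\<lambda>n. \<Prod>i<n. void_factor v (L i \<omega>)) \<longlonglongrightarrow>
    (\<Prod>l\<in>\<Phi> \<omega> \<inter> ({0..<2*pi} \<times> {0..v}). void_factor v l)"
  using lines_enum
proof (rule AE_mp, intro AE_I2 impI)
  fix \<omega> assume \<omega>: "\<omega> \<in> space M" and bij: "bij_betw (\<lambda>i. L i \<omega>) UNIV (\<Phi> \<omega>)"
  let ?B = "{0..<2*pi} \<times> {0..v}"
  have \<Phi>: "\<Phi> \<in> measurable M (config_space ({0..<2*pi} \<times> {0..}))"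
    using lines_PPP by (simp add: homogeneous_PPP_def)
  have fin: "finite (\<Phi> \<omega> \<inter> ?B)"
    by (rule finite_config_Int[OF \<Phi> \<omega> line_strip_borel_bounded(2)])
  have sub: "\<Phi> \<omega> \<subseteq> {0..<2*pi} \<times> {0..}"
    using measurable_space[OF \<Phi> \<omega>] by (simp add: space_config_space)
  define I where "I = {i. L i \<omega> \<in> ?B}"
  have bijI: "bij_betw (\<lambda>i. L i \<omega>) I (\<Phi> \<omega> \<inter> ?B)"
  proof (rule bij_betw_subset[OF bij])
    show "(\<lambda>i. L i \<omega>) ` I = \<Phi> \<omega> \<inter> ?B"
      unfolding I_def bij_betw_imp_surj_on[OF bij, symmetric] by (rule image_Collect_mem)
  qed simp
  then have "finite I"
    using fin bij_betw_finite by blast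
  then obtain k where k: "I \<subseteq> {..<k}"
    using finite_nat_iff_bounded by blast
  have one: "void_factor v (L i \<omega>) = 1" if "i \<notin> I" for i
  proof -
    have "L i \<omega> \<in> {0..<2*pi} \<times> {0..}"
      using bij sub by (auto simp: bij_betw_def)
    with that have "v \<le> snd (L i \<omega>)"
      by (auto simp: I_def)
    then have "v\<^sup>2 \<le> (snd (L i \<omega>))\<^sup>2"
      using assms by (intro power_mono)
    then show ?thesis by (simp add: void_factor_def max_def)
  qed
  have "(\<Prod>i<n. void_factor v (L i \<omega>)) = (\<Prod>l\<in>\<Phi> \<omega> \<inter> ?B. void_factor v l)" if "n \<ge> k" for n
  proof -
    have "(\<Prod>i<n. void_factor v (L i \<omega>)) = (\<Prod>i\<in>I. void_factor v (L i \<omega>))"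
      using k that one by (intro prod.mono_neutral_right) auto
    also have "\<dots> = (\<Prod>l\<in>\<Phi> \<omega> \<inter> ?B. void_factor v l)"
      by (rule prod.reindex_bij_betw[OF bijI])
    finally show ?thesis .
  qed
  then show "(\<lambda>n. \<Prod>i<n. void_factor v (L i \<omega>)) \<longlonglongrightarrow> (\<Prod>l\<in>\<Phi> \<omega> \<inter> ?B. void_factor v l)"
    by (intro tendsto_eventually eventually_sequentiallyI)
qed

text \<open>Two limits of the same sequence are equated: the void events \<open>D n\<close> of the
  first \<open>n\<close> lines decrease to the full void event, and their probabilities converge, by
  dominated convergence, to the generating functional of the line process.\<close>

lemma prob_void:
  "prob {\<omega> \<in> space M. typical_line_nodes \<theta>\<^sub>0 N \<omega> \<inter> ball 0 s = {} \<and> other_line_nodes L N \<omega> \<inter> ball 0 v = {}}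
    = exp (- 2 * lam\<^sub>v * max 0 s) * exp (- 2 * pi * lam\<^sub>l * void_exponent lam\<^sub>v (max 0 v))"
proof -
  define u where "u = max 0 v"
  have u: "u \<ge> 0" by (simp add: u_def)
  let ?B = "{0..<2*pi} \<times> {0..u}"
  let ?c = "exp (- 2 * lam\<^sub>v * max 0 s)"
  have B: "?B \<in> sets borel" "bounded ?B" "?B \<subseteq> {0..<2*pi} \<times> {0..}"
    using line_strip_borel_bounded by auto
  define D where "D n = {\<omega> \<in> space M. N None \<omega> \<inter> ball 0 s = {} \<and>
      (\<forall>i<n. N (Some i) \<omega> \<inter> ball 0 (sqrt (u\<^sup>2 - (snd (L i \<omega>))\<^sup>2)) = {})}" for n :: nat
  have "D n \<in> events" for n
    unfolding D_def by measurable
  moreover have "decseq D"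
    unfolding decseq_def D_def using order.strict_trans2 by blast
  ultimately have "(\<lambda>n. prob (D n)) \<longlonglongrightarrow> prob (\<Inter>n. D n)"
    by (intro finite_Lim_measure_decseq) auto
  moreover have "(\<Inter>n. D n) = {\<omega> \<in> space M. typical_line_nodes \<theta>\<^sub>0 N \<omega> \<inter> ball 0 s = {} \<and>
      other_line_nodes L N \<omega> \<inter> ball 0 v = {}}"
    unfolding typical_line_nodes_Int_ball other_line_nodes_Int_ball D_def u_def
    by (auto simp del: mem_ball_0)
  moreover have "(\<lambda>n. prob (D n)) \<longlonglongrightarrow> ?c * exp (- lam\<^sub>l * (2 * pi * void_exponent lam\<^sub>v u))"
  proof -
    note pgfl = PPP_pgfl[OF lines_PPP B void_factor_measurable void_factor_bounds, of u]
    have "(\<lambda>n. expectation (\<lambda>\<omega>. \<Prod>i<n. void_factor u (L i \<omega>)))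
        \<longlonglongrightarrow> expectation (\<lambda>\<omega>. \<Prod>l\<in>\<Phi> \<omega> \<inter> ?B. void_factor u l)"
      using AE_void_factor_prod[OF u]
      by (intro integral_dominated_convergence[where w="\<lambda>_. 1"])
        (auto simp: pgfl(1) abs_prod void_factor_bounds intro!: prod_le_1)
    then show ?thesis
      unfolding D_def prob_void_first_lines
      by (auto simp: pgfl(2) LBINT_void_factor[OF u] intro!: tendsto_intros)
  qed
  ultimately show ?thesis
    using LIMSEQ_unique by (fastforce simp: u_def ac_simps)
qed

end

section \<open>Nearest nodes\<close>

lemma set_integral_eq_nn_integral:
  fixes f :: "'a \<Rightarrow> real"
  assumes [measurable]: "f \<in> borel_measurable M" "A \<in> sets M" and "\<And>x. x \<in> A \<Longrightarrow> 0 \<le> f x"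
  shows "(LINT x:A|M. f x) = enn2real (\<integral>\<^sup>+x. ennreal (f x) * indicator A x \<partial>M)"
proof -
  have "(LINT x:A|M. f x) = enn2real (\<integral>\<^sup>+x. ennreal (indicator A x *\<^sub>R f x) \<partial>M)"
    unfolding set_lebesgue_integral_def
    using assms by (intro integral_eq_nn_integral) (auto simp: indicator_def)
  also have "(\<integral>\<^sup>+x. ennreal (indicator A x *\<^sub>R f x) \<partial>M)
      = (\<integral>\<^sup>+x. ennreal (f x) * indicator A x \<partial>M)"
    by (intro nn_integral_cong) (auto simp: indicator_def)
  finally show ?thesis .
qed

text \<open>Closed upper half-lines are an intersection-stable generator of the Borel sets, and they
  match the tail events \<open>a \<le> X\<close> that void probabilities deliver.\<close>

lemma distributedI_borel_atLeast:
  fixes X :: "'a \<Rightarrow> real" and f :: "real \<Rightarrow> ennreal"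
  assumes [measurable]: "X \<in> borel_measurable M" "f \<in> borel_measurable borel"
    and eq: "\<And>a. emeasure M {x \<in> space M. a \<le> X x} = (\<integral>\<^sup>+x. f x * indicator {a..} x \<partial>lborel)"
    and fin: "emeasure M (space M) \<noteq> \<infinity>"
  shows "distributed M lborel X f"
  unfolding distributed_def
proof (intro conjI)
  show "distr M lborel X = density lborel f"
  proof (rule measure_eqI_generator_eq[where E="range atLeast" and \<Omega>=UNIV and A="\<lambda>i. {- real i..}"])
    show "Int_stable (range atLeast :: real set set)"
    proof -
      have "{a..} \<inter> {b..} = {max a b..}" for a b :: real by auto
      then show ?thesis by (auto simp: Int_stable_def)
    qed
    have vim: "X -` {a..} \<inter> space M = {x \<in> space M. a \<le> X x}" for a
      by auto
    show "emeasure (distr M lborel X) Y = emeasure (density lborel f) Y" if "Y \<in> range atLeast" for Y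
      using that by (auto simp: emeasure_distr emeasure_density vim eq)
    show "sets (distr M lborel X) = sigma_sets UNIV (range atLeast)"
      "sets (density lborel f) = sigma_sets UNIV (range atLeast)"
      unfolding sets_distr sets_density sets_lborel by (subst borel_Ici; simp)+
    show "(\<Union>i. {- real i..}) = UNIV"
    proof (intro equalityI subsetI UNIV_I)
      fix x :: real
      obtain n where "- x \<le> real n" using real_arch_simple by blast
      then show "x \<in> (\<Union>i. {- real i..})" by (auto intro!: exI[of _ n])
    qed
    show "emeasure (distr M lborel X) {- real i..} \<noteq> \<infinity>" for i
      using emeasure_space[of M "X -` {- real i..} \<inter> space M"] fin
      by (auto simp: emeasure_distr top_unique)
  qed auto
qed simp_all

text \<open>Factorisation of closed tails is independence of two intersection-stable generators, and
  it extends to the generated sigma-algebras.\<close>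

lemma (in prob_space) indep_set_vimage_borel_atLeast:
  fixes X Y :: "'a \<Rightarrow> real"
  assumes [measurable]: "X \<in> borel_measurable M" "Y \<in> borel_measurable M"
    and eq: "\<And>a b. prob {\<omega> \<in> space M. a \<le> X \<omega> \<and> b \<le> Y \<omega>}
      = prob {\<omega> \<in> space M. a \<le> X \<omega>} * prob {\<omega> \<in> space M. b \<le> Y \<omega>}"
  shows "indep_set (sets (vimage_algebra (space M) X borel)) (sets (vimage_algebra (space M) Y borel))"
proof -
  define G where "G Z = {Z -` A \<inter> space M | A. A \<in> range atLeast}" for Z :: "'a \<Rightarrow> real"
  have gen: "sets (vimage_algebra (space M) Z borel) = sigma_sets (space M) (G Z)" for Z :: "'a \<Rightarrow> real"
    unfolding G_def sigma_sets_vimage_commute[of Z "space M" UNIV, simplified, symmetric]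
    by (subst sets_vimage_algebra2, simp, subst borel_Ici) simp
  have G: "G Z = range (\<lambda>a. {\<omega> \<in> space M. a \<le> Z \<omega>})" for Z :: "'a \<Rightarrow> real"
  proof -
    have "Z -` {a..} \<inter> space M = {\<omega> \<in> space M. a \<le> Z \<omega>}" for a
      by auto
    then show ?thesis by (simp add: G_def Setcompr_eq_image image_image)
  qed
  have Int: "Int_stable (G Z)" for Z :: "'a \<Rightarrow> real"
    unfolding Int_stable_def
  proof safe
    fix A B assume "A \<in> G Z" "B \<in> G Z"
    then obtain a b where "A = {\<omega> \<in> space M. a \<le> Z \<omega>}" "B = {\<omega> \<in> space M. b \<le> Z \<omega>}"
      by (auto simp: G)
    then have "A \<inter> B = {\<omega> \<in> space M. max a b \<le> Z \<omega>}" by auto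
    then show "A \<inter> B \<in> G Z" unfolding G by (rule range_eqI)
  qed
  have Int_eq: "{\<omega> \<in> space M. a \<le> X \<omega>} \<inter> {\<omega> \<in> space M. b \<le> Y \<omega>}
      = {\<omega> \<in> space M. a \<le> X \<omega> \<and> b \<le> Y \<omega>}" for a b
    by auto
  have "indep_set (G X) (G Y)"
    unfolding indep_sets2_eq G by (auto simp: Int_eq eq)
  then show ?thesis
    unfolding gen by (intro indep_set_sigma_sets Int)
qed

lemma f_S0_nonneg: "\<mu> > 0 \<Longrightarrow> f_S0 \<mu> s \<ge> 0"
  by (simp add: f_S0_def)

lemma borel_measurable_f_S0 [measurable]: "f_S0 \<mu> \<in> borel_measurable borel"
  unfolding f_S0_def [abs_def] by measurable

lemma F_S0_mono: "\<mu> > 0 \<Longrightarrow> r \<le> s \<Longrightarrow> F_S0 \<mu> r \<le> F_S0 \<mu> s"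
  by (auto simp: F_S0_def)

lemma F_S0_nonneg: "\<mu> > 0 \<Longrightarrow> 0 \<le> F_S0 \<mu> s"
  by (simp add: F_S0_def)

lemma borel_measurable_F_S0 [measurable]: "F_S0 \<mu> \<in> borel_measurable borel"
  unfolding F_S0_def [abs_def] by measurable

lemma nn_integral_f_S0_atLeast:
  assumes "\<mu> > 0"
  shows "(\<integral>\<^sup>+s. ennreal (f_S0 \<mu> s) * indicator {a..} s \<partial>lborel) = ennreal (exp (- 2 * \<mu> * max 0 a))"
proof -
  let ?f = "\<lambda>s. 2 * \<mu> * exp (- 2 * \<mu> * s)"
  have "(\<integral>\<^sup>+s. ennreal (f_S0 \<mu> s) * indicator {a..} s \<partial>lborel)
      = (\<integral>\<^sup>+s. ennreal (?f s) * indicator {max 0 a..} s \<partial>lborel)"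
    by (intro nn_integral_cong) (auto simp: f_S0_def indicator_def)
  also have "\<dots> = ennreal (0 - (- exp (- 2 * \<mu> * max 0 a)))"
  proof (rule nn_integral_FTC_atLeast)
    show "((\<lambda>s. - exp (- 2 * \<mu> * s)) \<longlongrightarrow> 0) at_top"
      using assms by real_asymp
  qed (use assms in \<open>auto intro!: derivative_eq_intros\<close>)
  finally show ?thesis by simp
qed

lemma nn_integral_f_S0_atMost:
  assumes "\<mu> > 0"
  shows "(\<integral>\<^sup>+s. ennreal (f_S0 \<mu> s) * indicator {..a} s \<partial>lborel) = ennreal (F_S0 \<mu> a)"
proof (cases "a < 0")
  case True
  then have "(\<integral>\<^sup>+s. ennreal (f_S0 \<mu> s) * indicator {..a} s \<partial>lborel) = (\<integral>\<^sup>+s. 0 \<partial>(lborel :: real measure))"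
    by (intro nn_integral_cong) (auto simp: f_S0_def indicator_def)
  then show ?thesis using True by (simp add: F_S0_def)
next
  case False
  let ?f = "\<lambda>s. 2 * \<mu> * exp (- 2 * \<mu> * s)"
  have "(\<integral>\<^sup>+s. ennreal (f_S0 \<mu> s) * indicator {..a} s \<partial>lborel)
      = (\<integral>\<^sup>+s. ennreal (?f s) * indicator {0..a} s \<partial>lborel)"
    by (intro nn_integral_cong) (auto simp: f_S0_def indicator_def)
  also have "\<dots> = ennreal ((- exp (- 2 * \<mu> * a)) - (- exp (- 2 * \<mu> * 0)))"
    by (rule nn_integral_FTC_Icc) (use assms False in \<open>auto intro!: derivative_eq_intros\<close>)
  finally show ?thesis using False by (simp add: F_S0_def)
qed

lemma nn_integral_f_V0_atLeast_max:
  assumes "\<mu> > 0" "lam > 0"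
  shows "(\<integral>\<^sup>+v. ennreal (f_V0 lam \<mu> v) * indicator {a..} v \<partial>lborel)
    = ennreal (exp (- 2 * pi * lam * void_exponent \<mu> (max 0 a)))"
  unfolding nn_integral_f_V0_atLeast[OF assms max.cobounded1, symmetric]
  by (intro nn_integral_cong) (auto simp: f_V0_def indicator_def)

text \<open>An empty set misses every ball, so its probability is bounded by each void probability
  and hence by their limit.\<close>

lemma (in prob_space) AE_not_empty_of_void:
  assumes [measurable]: "\<And>r. Measurable.pred M (\<lambda>\<omega>. A \<omega> \<inter> ball x r = {})"
    and lim: "(\<lambda>n. prob {\<omega> \<in> space M. A \<omega> \<inter> ball x (real n) = {}}) \<longlonglongrightarrow> 0"
  shows "AE \<omega> in M. A \<omega> \<noteq> {}"
proof -
  have eq: "{\<omega> \<in> space M. A \<omega> = {}} = {\<omega> \<in> space M. \<forall>n. A \<omega> \<inter> ball x (real n) = {}}"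
    using eq_empty_iff_Int_ball by blast
  have "{\<omega> \<in> space M. \<forall>n. A \<omega> \<inter> ball x (real n) = {}} \<in> events"
    by measurable
  then have ev: "{\<omega> \<in> space M. A \<omega> = {}} \<in> events"
    unfolding eq .
  have "prob {\<omega> \<in> space M. A \<omega> = {}} \<le> prob {\<omega> \<in> space M. A \<omega> \<inter> ball x (real n) = {}}" for n
    by (rule finite_measure_mono) auto
  then have "prob {\<omega> \<in> space M. A \<omega> = {}} \<le> 0"
    by (intro LIMSEQ_le_const[OF lim]) auto
  then have "prob {\<omega> \<in> space M. A \<omega> = {}} = 0"
    using measure_nonneg[of M] by (intro antisym)
  then have "AE \<omega> in M. \<omega> \<notin> {\<omega> \<in> space M. A \<omega> = {}}"
    using prob_eq_0[OF ev] by blast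
  then show ?thesis by (auto elim: AE_mp)
qed

section \<open>Laws of the two distances, and the serving event expressed through them\<close>

context poisson_line_cox
begin

lemma AE_typical_line_nodes_nonempty: "AE \<omega> in M. typical_line_nodes \<theta>\<^sub>0 N \<omega> \<noteq> {}"
proof (rule AE_not_empty_of_void[where x=0])
  have "(\<lambda>n. exp (- 2 * lam\<^sub>v * real n)) \<longlonglongrightarrow> 0"
    using intensity_nodes_pos by real_asymp
  \<comment> \<open>Radius 0 for the other lines makes their condition vacuous and their exponent 0,
    so the joint formula reduces to the typical line.\<close>
  then show "(\<lambda>n. prob {\<omega> \<in> space M. typical_line_nodes \<theta>\<^sub>0 N \<omega> \<inter> ball 0 (real n) = {}}) \<longlonglongrightarrow> 0"
    using prob_void[of \<theta>\<^sub>0 "real n" 0 for n] by (simp add: void_exponent_def ball_empty)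
qed measurable

lemma AE_other_line_nodes_nonempty: "AE \<omega> in M. other_line_nodes L N \<omega> \<noteq> {}"
proof (rule AE_not_empty_of_void[where x=0])
  have "filterlim (\<lambda>n. void_exponent lam\<^sub>v (real n)) at_top sequentially"
    by (rule filterlim_compose[OF filterlim_void_exponent[OF intensity_nodes_pos] filterlim_real_sequentially])
  then have "(\<lambda>n. exp (- (2 * pi * lam\<^sub>l * void_exponent lam\<^sub>v (real n)))) \<longlonglongrightarrow> 0"
    using intensity_lines_pos
    by (intro filterlim_compose[OF exp_at_bot] filterlim_compose[OF filterlim_uminus_at_bot_at_top]
        filterlim_tendsto_pos_mult_at_top[OF tendsto_const]) auto
  then show "(\<lambda>n. prob {\<omega> \<in> space M. other_line_nodes L N \<omega> \<inter> ball 0 (real n) = {}}) \<longlonglongrightarrow> 0"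
    using prob_void[of 0 0 "real n" for n] by (simp add: ball_empty)
qed measurable

text \<open>Off the null set where one of the node sets is empty and \<open>infdist\<close> takes
  its default value 0, the tail events are exactly void events.\<close>

lemma prob_tail:
  "prob {\<omega> \<in> space M. a \<le> S0_dist \<theta>\<^sub>0 N \<omega> \<and> b \<le> V0_dist L N \<omega>}
    = exp (- 2 * lam\<^sub>v * max 0 a) * exp (- 2 * pi * lam\<^sub>l * void_exponent lam\<^sub>v (max 0 b))"
proof -
  have "prob {\<omega> \<in> space M. a \<le> S0_dist \<theta>\<^sub>0 N \<omega> \<and> b \<le> V0_dist L N \<omega>}
    = prob {\<omega> \<in> space M. typical_line_nodes \<theta>\<^sub>0 N \<omega> \<inter> ball 0 a = {} \<and> other_line_nodes L N \<omega> \<inter> ball 0 b = {}}"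
  proof (rule finite_measure_eq_AE)
    show "AE \<omega> in M. \<omega> \<in> {\<omega> \<in> space M. a \<le> S0_dist \<theta>\<^sub>0 N \<omega> \<and> b \<le> V0_dist L N \<omega>} \<longleftrightarrow>
        \<omega> \<in> {\<omega> \<in> space M. typical_line_nodes \<theta>\<^sub>0 N \<omega> \<inter> ball 0 a = {} \<and> other_line_nodes L N \<omega> \<inter> ball 0 b = {}}"
      using AE_typical_line_nodes_nonempty[of \<theta>\<^sub>0] AE_other_line_nodes_nonempty
      by eventually_elim (simp add: S0_dist_def V0_dist_def infdist_ge_iff)
  qed measurable
  then show ?thesis by (simp add: prob_void)
qed

lemma prob_S0_tail: "prob {\<omega> \<in> space M. a \<le> S0_dist \<theta>\<^sub>0 N \<omega>} = exp (- 2 * lam\<^sub>v * max 0 a)"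
  using prob_tail[of a \<theta>\<^sub>0 0] by (simp add: V0_dist_def infdist_nonneg void_exponent_def)

lemma prob_V0_tail:
  "prob {\<omega> \<in> space M. b \<le> V0_dist L N \<omega>} = exp (- 2 * pi * lam\<^sub>l * void_exponent lam\<^sub>v (max 0 b))"
  using prob_tail[of 0 0 b] by (simp add: S0_dist_def infdist_nonneg)

lemma distributed_S0: "distributed M lborel (S0_dist \<theta>\<^sub>0 N) (\<lambda>s. ennreal (f_S0 lam\<^sub>v s))"
  by (rule distributedI_borel_atLeast)
    (simp_all add: emeasure_eq_measure prob_S0_tail nn_integral_f_S0_atLeast[OF intensity_nodes_pos])

lemma distributed_V0: "distributed M lborel (V0_dist L N) (\<lambda>v. ennreal (f_V0 lam\<^sub>l lam\<^sub>v v))"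
  by (rule distributedI_borel_atLeast)
    (simp_all add: emeasure_eq_measure prob_V0_tail intensity_nodes_pos
      nn_integral_f_V0_atLeast_max[OF intensity_nodes_pos intensity_lines_pos])

text \<open>The tails factorise at every pair of thresholds, so the distances are independent and
  the joint law is the product of the marginals. \<open>borel\<close> and \<open>lborel\<close> are
  interchangeable as targets since only their sigma-algebra matters.\<close>

lemma distr_S0_V0:
  "distr M (borel \<Otimes>\<^sub>M borel) (\<lambda>\<omega>. (S0_dist \<theta>\<^sub>0 N \<omega>, V0_dist L N \<omega>))
    = density lborel (\<lambda>s. ennreal (f_S0 lam\<^sub>v s)) \<Otimes>\<^sub>M density lborel (\<lambda>v. ennreal (f_V0 lam\<^sub>l lam\<^sub>v v))"
proof -
  have "distr M borel (S0_dist \<theta>\<^sub>0 N) = distr M lborel (S0_dist \<theta>\<^sub>0 N)"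
    "distr M borel (V0_dist L N) = distr M lborel (V0_dist L N)"
    by (auto intro!: distr_cong)
  moreover have "distr M borel (S0_dist \<theta>\<^sub>0 N) \<Otimes>\<^sub>M distr M borel (V0_dist L N)
      = distr M (borel \<Otimes>\<^sub>M borel) (\<lambda>\<omega>. (S0_dist \<theta>\<^sub>0 N \<omega>, V0_dist L N \<omega>))"
    by (intro distr_Pair_indep_set indep_set_vimage_borel_atLeast)
      (simp_all add: prob_tail prob_S0_tail prob_V0_tail)
  ultimately show ?thesis
    using distributed_S0[of \<theta>\<^sub>0] distributed_V0 by (simp add: distributed_def)
qed

text \<open>One region, the pairs with \<open>s \<in> A\<close> and \<open>s \<le> v\<close>, sliced
  in both directions under the product law. Integrating out \<open>v\<close> first gives the density
  in \<open>s\<close>; integrating out \<open>s\<close> first gives the form with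
  \<open>F_S0\<close> under an integral over \<open>v\<close>.\<close>

lemma
  assumes [measurable]: "A \<in> sets borel"
  shows emeasure_S0_le_V0:
      "emeasure M {\<omega> \<in> space M. S0_dist \<theta>\<^sub>0 N \<omega> \<in> A \<and> S0_dist \<theta>\<^sub>0 N \<omega> \<le> V0_dist L N \<omega>}
      = (\<integral>\<^sup>+s. ennreal (f_S0 lam\<^sub>v s) * ennreal (exp (- 2 * pi * lam\<^sub>l * void_exponent lam\<^sub>v (max 0 s)))
          * indicator A s \<partial>lborel)"
    and emeasure_S0_le_V0':
      "emeasure M {\<omega> \<in> space M. S0_dist \<theta>\<^sub>0 N \<omega> \<in> A \<and> S0_dist \<theta>\<^sub>0 N \<omega> \<le> V0_dist L N \<omega>}
      = (\<integral>\<^sup>+v. ennreal (f_V0 lam\<^sub>l lam\<^sub>v v) *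
          (\<integral>\<^sup>+s. ennreal (f_S0 lam\<^sub>v s) * indicator (A \<inter> {..v}) s \<partial>lborel) \<partial>lborel)"
proof -
  let ?S = "density lborel (\<lambda>s. ennreal (f_S0 lam\<^sub>v s))"
  let ?V = "density lborel (\<lambda>v. ennreal (f_V0 lam\<^sub>l lam\<^sub>v v))"
  let ?Q = "{z :: real \<times> real. fst z \<in> A \<and> fst z \<le> snd z}"
  have [measurable]: "f_V0 lam\<^sub>l lam\<^sub>v \<in> borel_measurable borel"
    by (rule borel_measurable_f_V0[OF intensity_nodes_pos])
  interpret S: prob_space ?S
    unfolding distributed_distr_eq_density[OF distributed_S0[of 0], symmetric]
    by (rule prob_space_distr) simp
  interpret V: prob_space ?V
    unfolding distributed_distr_eq_density[OF distributed_V0, symmetric]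
    by (rule prob_space_distr) simp
  interpret SV: pair_sigma_finite ?S ?V ..
  have "?Q = {z \<in> space (borel \<Otimes>\<^sub>M borel). fst z \<in> A \<and> fst z \<le> snd z}"
    by (simp add: space_pair_measure)
  also have "\<dots> \<in> sets (borel \<Otimes>\<^sub>M borel)"
    by measurable
  finally have Q: "?Q \<in> sets (borel \<Otimes>\<^sub>M borel)" .
  then have Q': "?Q \<in> sets (?S \<Otimes>\<^sub>M ?V)"
    by (simp cong: sets_pair_measure_cong)
  have "{\<omega> \<in> space M. S0_dist \<theta>\<^sub>0 N \<omega> \<in> A \<and> S0_dist \<theta>\<^sub>0 N \<omega> \<le> V0_dist L N \<omega>}
      = (\<lambda>\<omega>. (S0_dist \<theta>\<^sub>0 N \<omega>, V0_dist L N \<omega>)) -` ?Q \<inter> space M"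
    by auto
  then have joint: "emeasure M {\<omega> \<in> space M. S0_dist \<theta>\<^sub>0 N \<omega> \<in> A \<and> S0_dist \<theta>\<^sub>0 N \<omega> \<le> V0_dist L N \<omega>}
      = emeasure (?S \<Otimes>\<^sub>M ?V) ?Q"
    unfolding distr_S0_V0[of \<theta>\<^sub>0, symmetric] by (subst emeasure_distr[OF _ Q]) auto
  have V: "emeasure ?V (Pair s -` ?Q)
      = indicator A s * ennreal (exp (- 2 * pi * lam\<^sub>l * void_exponent lam\<^sub>v (max 0 s)))" for s
  proof -
    have "Pair s -` ?Q = (if s \<in> A then {s..} else {})"
      by auto
    then show ?thesis
      by (simp add: emeasure_density nn_integral_f_V0_atLeast_max[OF intensity_nodes_pos intensity_lines_pos])
  qed
  have "emeasure (?S \<Otimes>\<^sub>M ?V) ?Q = (\<integral>\<^sup>+s. emeasure ?V (Pair s -` ?Q) \<partial>?S)"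
    by (rule V.emeasure_pair_measure_alt[OF Q'])
  also have "\<dots> = (\<integral>\<^sup>+s. ennreal (f_S0 lam\<^sub>v s) * emeasure ?V (Pair s -` ?Q) \<partial>lborel)"
    using V.measurable_emeasure_Pair[OF Q'] by (subst nn_integral_density) simp_all
  finally show "emeasure M {\<omega> \<in> space M. S0_dist \<theta>\<^sub>0 N \<omega> \<in> A \<and> S0_dist \<theta>\<^sub>0 N \<omega> \<le> V0_dist L N \<omega>}
      = (\<integral>\<^sup>+s. ennreal (f_S0 lam\<^sub>v s) * ennreal (exp (- 2 * pi * lam\<^sub>l * void_exponent lam\<^sub>v (max 0 s)))
          * indicator A s \<partial>lborel)"
    unfolding joint V by (simp add: ac_simps)
  have S: "emeasure ?S ((\<lambda>s. (s, v)) -` ?Q)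
      = (\<integral>\<^sup>+s. ennreal (f_S0 lam\<^sub>v s) * indicator (A \<inter> {..v}) s \<partial>lborel)" for v
  proof -
    have "(\<lambda>s. (s, v)) -` ?Q = A \<inter> {..v}"
      by auto
    then show ?thesis by (simp add: emeasure_density)
  qed
  have "emeasure (?S \<Otimes>\<^sub>M ?V) ?Q = (\<integral>\<^sup>+v. emeasure ?S ((\<lambda>s. (s, v)) -` ?Q) \<partial>?V)"
    by (rule SV.emeasure_pair_measure_alt2[OF Q'])
  also have "\<dots> = (\<integral>\<^sup>+v. ennreal (f_V0 lam\<^sub>l lam\<^sub>v v) * emeasure ?S ((\<lambda>s. (s, v)) -` ?Q) \<partial>lborel)"
    using SV.measurable_emeasure_Pair1[OF Q'] by (subst nn_integral_density) simp_all
  finally show "emeasure M {\<omega> \<in> space M. S0_dist \<theta>\<^sub>0 N \<omega> \<in> A \<and> S0_dist \<theta>\<^sub>0 N \<omega> \<le> V0_dist L N \<omega>}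
      = (\<integral>\<^sup>+v. ennreal (f_V0 lam\<^sub>l lam\<^sub>v v) *
          (\<integral>\<^sup>+s. ennreal (f_S0 lam\<^sub>v s) * indicator (A \<inter> {..v}) s \<partial>lborel) \<partial>lborel)"
    unfolding joint S .
qed

text \<open>Nodes no farther from the origin than a given one are finitely many by local finiteness,
  so a nearest one exists. The serving event asks for an actual node on the typical line, whereas
  the other lines enter only through lower bounds on their nodes.\<close>

lemma typical_line_nodes_attains_inf:
  assumes "\<omega> \<in> space M" "typical_line_nodes \<theta>\<^sub>0 N \<omega> \<noteq> {}"
  obtains x where "x \<in> typical_line_nodes \<theta>\<^sub>0 N \<omega>" "\<And>y. y \<in> typical_line_nodes \<theta>\<^sub>0 N \<omega> \<Longrightarrow> norm x \<le> norm y"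
proof -
  obtain t where t: "t \<in> N None \<omega>"
    using assms(2) by (auto simp: typical_line_nodes_def)
  have "finite (N None \<omega> \<inter> cball 0 \<bar>t\<bar>)"
    by (rule finite_config_Int[OF nodes_measurable assms(1)]) simp
  then obtain u where u: "u \<in> N None \<omega> \<inter> cball 0 \<bar>t\<bar>"
    "\<And>w. w \<in> N None \<omega> \<inter> cball 0 \<bar>t\<bar> \<Longrightarrow> \<bar>u\<bar> \<le> \<bar>w\<bar>"
    using arg_min_if_finite[of "N None \<omega> \<inter> cball 0 \<bar>t\<bar>" abs] t
    by (metis IntI empty_iff linorder_not_le mem_cball_0 order_refl real_norm_def)
  have "\<bar>u\<bar> \<le> \<bar>w\<bar>" if "w \<in> N None \<omega>" for w
    using u that by (cases "\<bar>w\<bar> \<le> \<bar>t\<bar>") auto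
  then show ?thesis
    using u(1) by (intro that[of "line_point (\<theta>\<^sub>0, 0) u"]) (auto simp: typical_line_nodes_def norm_line_point)
qed

text \<open>Proved at every sample, not just almost surely, because measurability of the event is
  read off from it. The case of no other nodes is listed separately: there \<open>V0_dist\<close> is
  the default 0, yet any nearest typical node serves.\<close>

lemma mem_serving_on_typical_iff:
  assumes "\<omega> \<in> space M"
  shows "\<omega> \<in> serving_on_typical M \<theta>\<^sub>0 L N \<longleftrightarrow> typical_line_nodes \<theta>\<^sub>0 N \<omega> \<noteq> {} \<and>
    (other_line_nodes L N \<omega> = {} \<or> S0_dist \<theta>\<^sub>0 N \<omega> \<le> V0_dist L N \<omega>)"
    (is "?E \<longleftrightarrow> ?T \<noteq> {} \<and> (?O = {} \<or> ?S \<le> ?V)")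
proof (cases "?T = {}")
  case True
  then show ?thesis by (simp add: serving_on_typical_def)
next
  case T: False
  obtain x where x: "x \<in> ?T" "\<And>y. y \<in> ?T \<Longrightarrow> norm x \<le> norm y"
    using typical_line_nodes_attains_inf[OF assms T] by blast
  show ?thesis
  proof (cases "?O = {}")
    case True
    with x assms have ?E
      unfolding serving_on_typical_def all_nodes_def dist_0_norm by blast
    with True T show ?thesis by simp
  next
    case False
    then have le_V: "r \<le> ?V \<longleftrightarrow> (\<forall>y\<in>?O. r \<le> norm y)" for r
      by (simp add: V0_dist_def infdist_ge_iff Int_ball_0_eq_empty_iff not_less)
    show ?thesis
    proof
      assume ?E
      then obtain z where "z \<in> ?T" "\<forall>y\<in>?O. norm z \<le> norm y"
        unfolding serving_on_typical_def all_nodes_def dist_0_norm by blast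
      then have "?S \<le> norm z" "norm z \<le> ?V"
        using infdist_le[of z ?T 0] by (simp_all add: le_V S0_dist_def)
      with T show "?T \<noteq> {} \<and> (?O = {} \<or> ?S \<le> ?V)" by linarith
    next
      assume "?T \<noteq> {} \<and> (?O = {} \<or> ?S \<le> ?V)"
      with False have "?S \<le> ?V" by blast
      have "norm x \<le> ?S"
        using x T by (simp add: S0_dist_def infdist_ge_iff Int_ball_0_eq_empty_iff not_less)
      with \<open>?S \<le> ?V\<close> have "\<forall>y\<in>?O. norm x \<le> norm y"
        unfolding le_V[symmetric] by linarith
      with x assms show ?E
        unfolding serving_on_typical_def all_nodes_def dist_0_norm by blast
    qed
  qed
qed

lemma serving_on_typical_measurable [measurable]: "serving_on_typical M \<theta>\<^sub>0 L N \<in> events"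
proof -
  have "serving_on_typical M \<theta>\<^sub>0 L N = {\<omega> \<in> space M.
      \<not> (\<forall>n::nat. typical_line_nodes \<theta>\<^sub>0 N \<omega> \<inter> ball 0 (real n) = {}) \<and>
      ((\<forall>n::nat. other_line_nodes L N \<omega> \<inter> ball 0 (real n) = {}) \<or> S0_dist \<theta>\<^sub>0 N \<omega> \<le> V0_dist L N \<omega>)}"
    unfolding eq_empty_iff_Int_ball[of _ 0, symmetric]
    using mem_serving_on_typical_iff[of _ \<theta>\<^sub>0] by (auto simp: serving_on_typical_def)
  also have "\<dots> \<in> events"
    by measurable
  finally show ?thesis .
qed

lemma AE_mem_serving_on_typical:
  "AE \<omega> in M. \<omega> \<in> serving_on_typical M \<theta>\<^sub>0 L N \<longleftrightarrow> S0_dist \<theta>\<^sub>0 N \<omega> \<le> V0_dist L N \<omega>"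
  using AE_typical_line_nodes_nonempty[of \<theta>\<^sub>0] AE_other_line_nodes_nonempty AE_space
  by eventually_elim (simp add: mem_serving_on_typical_iff)

lemma AE_serving_dist:
  "AE \<omega> in M. serving_dist \<theta>\<^sub>0 L N \<omega> = min (S0_dist \<theta>\<^sub>0 N \<omega>) (V0_dist L N \<omega>)"
  using AE_typical_line_nodes_nonempty[of \<theta>\<^sub>0] AE_other_line_nodes_nonempty
  by eventually_elim (simp add: serving_dist_def S0_dist_def V0_dist_def all_nodes_def infdist_Un_min)

text \<open>Almost surely the serving distance is the minimum of the two distances, which is
  \<open>S0_dist\<close> on this event. A tie counts as service from the typical line on both
  sides.\<close>

lemma emeasure_serving_on_typical_Int:
  assumes [measurable]: "A \<in> sets borel"
  shows "emeasure M (serving_on_typical M \<theta>\<^sub>0 L N \<inter> {\<omega> \<in> space M. serving_dist \<theta>\<^sub>0 L N \<omega> \<in> A})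
    = emeasure M {\<omega> \<in> space M. S0_dist \<theta>\<^sub>0 N \<omega> \<in> A \<and> S0_dist \<theta>\<^sub>0 N \<omega> \<le> V0_dist L N \<omega>}"
proof (rule emeasure_eq_AE)
  show "AE \<omega> in M. \<omega> \<in> serving_on_typical M \<theta>\<^sub>0 L N \<inter> {\<omega> \<in> space M. serving_dist \<theta>\<^sub>0 L N \<omega> \<in> A} \<longleftrightarrow>
      \<omega> \<in> {\<omega> \<in> space M. S0_dist \<theta>\<^sub>0 N \<omega> \<in> A \<and> S0_dist \<theta>\<^sub>0 N \<omega> \<le> V0_dist L N \<omega>}"
    using AE_mem_serving_on_typical[of \<theta>\<^sub>0] AE_serving_dist[of \<theta>\<^sub>0]
    by eventually_elim (auto simp: min_def)
qed measurable

end

text \<open>Splitting the lower tail at \<open>r\<close>; the common term cancels in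
  \<open>ennreal\<close> because it is finite.\<close>

lemma nn_integral_f_S0_Ioc:
  assumes "\<mu> > 0" "r \<le> v"
  shows "(\<integral>\<^sup>+s. ennreal (f_S0 \<mu> s) * indicator ({r<..} \<inter> {..v}) s \<partial>lborel)
    = ennreal (F_S0 \<mu> v - F_S0 \<mu> r)"
proof -
  let ?I = "\<integral>\<^sup>+s. ennreal (f_S0 \<mu> s) * indicator ({r<..} \<inter> {..v}) s \<partial>lborel"
  have "(\<integral>\<^sup>+s. ennreal (f_S0 \<mu> s) * indicator {..v} s \<partial>lborel)
      = (\<integral>\<^sup>+s. ennreal (f_S0 \<mu> s) * indicator {..r} s
          + ennreal (f_S0 \<mu> s) * indicator ({r<..} \<inter> {..v}) s \<partial>lborel)"
    using assms(2) by (intro nn_integral_cong) (auto simp: indicator_def)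
  also have "\<dots> = (\<integral>\<^sup>+s. ennreal (f_S0 \<mu> s) * indicator {..r} s \<partial>lborel) + ?I"
    by (rule nn_integral_add) measurable
  finally have "ennreal (F_S0 \<mu> v) = ennreal (F_S0 \<mu> r) + ?I"
    by (simp add: nn_integral_f_S0_atMost[OF assms(1)])
  moreover have "ennreal (F_S0 \<mu> v) = ennreal (F_S0 \<mu> r) + ennreal (F_S0 \<mu> v - F_S0 \<mu> r)"
    using F_S0_nonneg[OF assms(1)] F_S0_mono[OF assms]
    by (subst ennreal_plus[symmetric]) auto
  ultimately have "ennreal (F_S0 \<mu> r) + ?I = ennreal (F_S0 \<mu> r) + ennreal (F_S0 \<mu> v - F_S0 \<mu> r)"
    by simp
  then show ?thesis
    unfolding ennreal_add_left_cancel by simp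
qed

section \<open>Probability of the serving event and the conditional laws of the serving
  distance\<close>

context poisson_line_cox
begin

lemma cdf_S0: "cdf (distr M borel (S0_dist \<theta>\<^sub>0 N)) s = F_S0 lam\<^sub>v s"
proof -
  have "distr M borel (S0_dist \<theta>\<^sub>0 N) = distr M lborel (S0_dist \<theta>\<^sub>0 N)"
    by (rule distr_cong) auto
  also have "\<dots> = density lborel (\<lambda>s. ennreal (f_S0 lam\<^sub>v s))"
    by (rule distributed_distr_eq_density[OF distributed_S0])
  finally show ?thesis
    by (simp add: cdf_def measure_def emeasure_density nn_integral_f_S0_atMost[OF intensity_nodes_pos]
        F_S0_nonneg[OF intensity_nodes_pos])
qed

text \<open>The event contains, up to a null set, the samples with \<open>S0_dist\<close> below 1
  and \<open>V0_dist\<close> at least 1, whose probability is a difference of two tails; the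
  threshold 1 is arbitrary. Positivity makes \<open>uniform_measure\<close> the conditional
  probability and permits the division.\<close>

lemma prob_serving_on_typical_pos: "prob (serving_on_typical M \<theta>\<^sub>0 L N) > 0"
proof -
  let ?A = "{\<omega> \<in> space M. 1 \<le> V0_dist L N \<omega>}"
  let ?B = "{\<omega> \<in> space M. 1 \<le> S0_dist \<theta>\<^sub>0 N \<omega> \<and> 1 \<le> V0_dist L N \<omega>}"
  have "0 < exp (- 2 * pi * lam\<^sub>l * void_exponent lam\<^sub>v 1) * (1 - exp (- 2 * lam\<^sub>v))"
    using intensity_nodes_pos by simp
  also have "\<dots> = prob ?A - prob ?B"
    by (simp add: prob_tail prob_V0_tail algebra_simps)
  also have "\<dots> = prob (?A - ?B)"
    by (rule finite_measure_Diff[symmetric]) auto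
  also have "\<dots> \<le> prob {\<omega> \<in> space M. S0_dist \<theta>\<^sub>0 N \<omega> \<in> UNIV \<and> S0_dist \<theta>\<^sub>0 N \<omega> \<le> V0_dist L N \<omega>}"
    by (rule finite_measure_mono) auto
  also have "\<dots> = prob (serving_on_typical M \<theta>\<^sub>0 L N \<inter> {\<omega> \<in> space M. serving_dist \<theta>\<^sub>0 L N \<omega> \<in> UNIV})"
    using emeasure_serving_on_typical_Int[of UNIV \<theta>\<^sub>0] by (simp add: measure_def)
  also have "\<dots> \<le> prob (serving_on_typical M \<theta>\<^sub>0 L N)"
    by (rule finite_measure_mono) auto
  finally show ?thesis .
qed

lemma prob_serving_on_typical:
  "prob (serving_on_typical M \<theta>\<^sub>0 L N) = (LBINT v:{0..}. F_S0 lam\<^sub>v v * f_V0 lam\<^sub>l lam\<^sub>v v)"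
proof -
  note [measurable] = borel_measurable_f_V0[OF intensity_nodes_pos]
  have E: "serving_on_typical M \<theta>\<^sub>0 L N \<inter> {\<omega> \<in> space M. serving_dist \<theta>\<^sub>0 L N \<omega> \<in> UNIV}
      = serving_on_typical M \<theta>\<^sub>0 L N"
    by (auto simp: serving_on_typical_def)
  have "emeasure M (serving_on_typical M \<theta>\<^sub>0 L N)
      = (\<integral>\<^sup>+v. ennreal (f_V0 lam\<^sub>l lam\<^sub>v v) *
          (\<integral>\<^sup>+s. ennreal (f_S0 lam\<^sub>v s) * indicator (UNIV \<inter> {..v}) s \<partial>lborel) \<partial>lborel)"
    using emeasure_serving_on_typical_Int[of UNIV \<theta>\<^sub>0] emeasure_S0_le_V0'[of UNIV \<theta>\<^sub>0]
    unfolding E by simp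
  also have "\<dots> = (\<integral>\<^sup>+v. ennreal (f_V0 lam\<^sub>l lam\<^sub>v v) * ennreal (F_S0 lam\<^sub>v v) \<partial>lborel)"
    by (simp add: nn_integral_f_S0_atMost[OF intensity_nodes_pos])
  also have "\<dots> = (\<integral>\<^sup>+v. ennreal (F_S0 lam\<^sub>v v * f_V0 lam\<^sub>l lam\<^sub>v v) * indicator {0..} v \<partial>lborel)"
  proof (rule nn_integral_cong)
    fix v
    show "ennreal (f_V0 lam\<^sub>l lam\<^sub>v v) * ennreal (F_S0 lam\<^sub>v v)
        = ennreal (F_S0 lam\<^sub>v v * f_V0 lam\<^sub>l lam\<^sub>v v) * indicator {0..} v"
      using F_S0_nonneg[OF intensity_nodes_pos] f_V0_nonneg[OF intensity_nodes_pos intensity_lines_pos]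
      by (cases "v < 0") (simp add: F_S0_def, simp add: ennreal_mult mult.commute)
  qed
  finally show ?thesis
    using f_V0_nonneg[OF intensity_nodes_pos intensity_lines_pos] F_S0_nonneg[OF intensity_nodes_pos]
    by (subst set_integral_eq_nn_integral) (simp_all add: measure_def)
qed

text \<open>For fixed \<open>v\<close> the admissible \<open>s\<close> fill the interval from
  \<open>r\<close> to \<open>v\<close>. It is empty for \<open>v < r\<close>, which is where the
  lower limit of the outer integral comes from.\<close>

lemma prob_serving_on_typical_gt:
  assumes "r \<ge> 0"
  shows "prob (serving_on_typical M \<theta>\<^sub>0 L N \<inter> {\<omega> \<in> space M. r < serving_dist \<theta>\<^sub>0 L N \<omega>})
    = (LBINT v:{r..}. (F_S0 lam\<^sub>v v - F_S0 lam\<^sub>v r) * f_V0 lam\<^sub>l lam\<^sub>v v)"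
proof -
  note [measurable] = borel_measurable_f_V0[OF intensity_nodes_pos]
  note nonneg = f_V0_nonneg[OF intensity_nodes_pos intensity_lines_pos] F_S0_mono[OF intensity_nodes_pos]
  have "emeasure M (serving_on_typical M \<theta>\<^sub>0 L N \<inter> {\<omega> \<in> space M. r < serving_dist \<theta>\<^sub>0 L N \<omega>})
      = (\<integral>\<^sup>+v. ennreal (f_V0 lam\<^sub>l lam\<^sub>v v) *
          (\<integral>\<^sup>+s. ennreal (f_S0 lam\<^sub>v s) * indicator ({r<..} \<inter> {..v}) s \<partial>lborel) \<partial>lborel)"
    using emeasure_serving_on_typical_Int[of "{r<..}" \<theta>\<^sub>0] emeasure_S0_le_V0'[of "{r<..}" \<theta>\<^sub>0]
    by simp
  also have "\<dots> = (\<integral>\<^sup>+v. ennreal ((F_S0 lam\<^sub>v v - F_S0 lam\<^sub>v r) * f_V0 lam\<^sub>l lam\<^sub>v v) * indicator {r..} v \<partial>lborel)"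
  proof (rule nn_integral_cong)
    fix v
    show "ennreal (f_V0 lam\<^sub>l lam\<^sub>v v) *
          (\<integral>\<^sup>+s. ennreal (f_S0 lam\<^sub>v s) * indicator ({r<..} \<inter> {..v}) s \<partial>lborel)
        = ennreal ((F_S0 lam\<^sub>v v - F_S0 lam\<^sub>v r) * f_V0 lam\<^sub>l lam\<^sub>v v) * indicator {r..} v"
    proof (cases "r \<le> v")
      case True
      then show ?thesis
        using nonneg(1) nonneg(2)[OF True]
        by (simp add: nn_integral_f_S0_Ioc[OF intensity_nodes_pos] ennreal_mult mult.commute)
    next
      case False
      then have "{r<..} \<inter> {..v} = {}" by auto
      with False show ?thesis by simp
    qed
  qed
  finally show ?thesis
    using nonneg by (subst set_integral_eq_nn_integral) (simp_all add: measure_def)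
qed

lemma cdf_serving_dist:
  assumes "r \<ge> 0"
  shows "cdf (distr (uniform_measure M (serving_on_typical M \<theta>\<^sub>0 L N)) borel (serving_dist \<theta>\<^sub>0 L N)) r
    = 1 - 1 / prob (serving_on_typical M \<theta>\<^sub>0 L N) *
        (LBINT v:{r..}. (F_S0 lam\<^sub>v v - F_S0 lam\<^sub>v r) * f_V0 lam\<^sub>l lam\<^sub>v v)"
proof -
  let ?E = "serving_on_typical M \<theta>\<^sub>0 L N" and ?R = "serving_dist \<theta>\<^sub>0 L N"
  let ?B = "?E \<inter> {\<omega> \<in> space M. r < ?R \<omega>}"
  have pos: "prob ?E > 0"
    by (rule prob_serving_on_typical_pos)
  have sub: "?E \<subseteq> space M"
    by (auto simp: serving_on_typical_def)
  have "cdf (distr (uniform_measure M ?E) borel ?R) r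
      = measure (uniform_measure M ?E) (?R -` {..r} \<inter> space M)"
    by (simp add: cdf_def measure_distr)
  also have "\<dots> = prob (?E \<inter> (?R -` {..r} \<inter> space M)) / prob ?E"
    using pos by (intro measure_uniform_measure) (auto simp: emeasure_eq_measure)
  also have "?E \<inter> (?R -` {..r} \<inter> space M) = ?E - ?B"
    using sub by auto
  also have "prob (?E - ?B) = prob ?E - prob ?B"
    by (rule finite_measure_Diff) auto
  also have "(prob ?E - prob ?B) / prob ?E = 1 - 1 / prob ?E * prob ?B"
    using pos by (simp add: field_simps)
  finally show ?thesis
    by (simp only: prob_serving_on_typical_gt[OF assms])
qed

text \<open>Integrating out \<open>V0_dist\<close> first leaves the density of
  \<open>S0_dist\<close> at \<open>r\<close> times the tail of \<open>V0_dist\<close> there, divided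
  by the probability of the conditioning event.\<close>

lemma distributed_serving_dist:
  "distributed (uniform_measure M (serving_on_typical M \<theta>\<^sub>0 L N)) lborel (serving_dist \<theta>\<^sub>0 L N)
    (\<lambda>r. ennreal (if r < 0 then 0 else 1 / prob (serving_on_typical M \<theta>\<^sub>0 L N) *
      (LBINT v:{r..}. f_S0 lam\<^sub>v r * f_V0 lam\<^sub>l lam\<^sub>v v)))"
proof -
  note [measurable] = borel_measurable_f_V0[OF intensity_nodes_pos]
  let ?E = "serving_on_typical M \<theta>\<^sub>0 L N" and ?R = "serving_dist \<theta>\<^sub>0 L N"
  let ?p = "prob ?E"
  let ?T = "\<lambda>r. exp (- 2 * pi * lam\<^sub>l * void_exponent lam\<^sub>v (max 0 r))"
  have pos: "?p > 0"
    by (rule prob_serving_on_typical_pos)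
  have [measurable]: "void_exponent lam\<^sub>v \<in> borel_measurable borel"
    using has_real_derivative_void_exponent
    by (auto intro!: borel_measurable_continuous_onI DERIV_continuous_on)
  \<comment> \<open>The integral over \<open>v\<close> is evaluated to an explicit function of
    \<open>r\<close>, which also makes the density measurable; the separate case
    \<open>r < 0\<close> is then absorbed because \<open>f_S0\<close> vanishes there.\<close>
  have LBINT: "(LBINT v:{r..}. f_S0 lam\<^sub>v r * f_V0 lam\<^sub>l lam\<^sub>v v) = f_S0 lam\<^sub>v r * ?T r" for r
  proof -
    have "(LBINT v:{r..}. f_V0 lam\<^sub>l lam\<^sub>v v) = ?T r"
      using f_V0_nonneg[OF intensity_nodes_pos intensity_lines_pos]
      by (subst set_integral_eq_nn_integral)
        (simp_all add: nn_integral_f_V0_atLeast_max[OF intensity_nodes_pos intensity_lines_pos])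
    then show ?thesis by simp
  qed
  have "(\<lambda>r. ennreal (if r < 0 then 0 else 1 / ?p * (LBINT v:{r..}. f_S0 lam\<^sub>v r * f_V0 lam\<^sub>l lam\<^sub>v v)))
      = (\<lambda>r. ennreal (f_S0 lam\<^sub>v r * ?T r / ?p))"
    unfolding LBINT by (auto simp: f_S0_def fun_eq_iff)
  moreover have "distributed (uniform_measure M ?E) lborel ?R (\<lambda>r. ennreal (f_S0 lam\<^sub>v r * ?T r / ?p))"
    unfolding distributed_def
  proof (intro conjI measure_eqI)
    fix A assume "A \<in> sets (distr (uniform_measure M ?E) lborel ?R)"
    then have A [measurable]: "A \<in> sets borel" by simp
    have "emeasure (distr (uniform_measure M ?E) lborel ?R) A
        = emeasure (uniform_measure M ?E) (?R -` A \<inter> space M)"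
      by (subst emeasure_distr) auto
    also have "\<dots> = emeasure M (?E \<inter> (?R -` A \<inter> space M)) / emeasure M ?E"
      by (rule emeasure_uniform_measure) auto
    also have "?E \<inter> (?R -` A \<inter> space M) = ?E \<inter> {\<omega> \<in> space M. ?R \<omega> \<in> A}"
      by auto
    also have "emeasure M \<dots> / emeasure M ?E
        = (\<integral>\<^sup>+r. ennreal (f_S0 lam\<^sub>v r) * ennreal (?T r) * indicator A r \<partial>lborel) / ennreal ?p"
      by (simp only: emeasure_serving_on_typical_Int[OF A] emeasure_S0_le_V0[OF A] emeasure_eq_measure[of ?E])
    also have "\<dots> = (\<integral>\<^sup>+r. ennreal (f_S0 lam\<^sub>v r) * ennreal (?T r) * indicator A r / ennreal ?p \<partial>lborel)"
      by (rule nn_integral_divide[symmetric]) measurable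
    also have "\<dots> = (\<integral>\<^sup>+r. ennreal (f_S0 lam\<^sub>v r * ?T r / ?p) * indicator A r \<partial>lborel)"
      using pos f_S0_nonneg[OF intensity_nodes_pos]
      by (intro nn_integral_cong) (auto simp: indicator_def divide_ennreal simp flip: ennreal_mult)
    finally show "emeasure (distr (uniform_measure M ?E) lborel ?R) A
        = emeasure (density lborel (\<lambda>r. ennreal (f_S0 lam\<^sub>v r * ?T r / ?p))) A"
      by (simp add: emeasure_density)
  qed simp_all
  ultimately show ?thesis by simp
qed

end

theorem lemma9:
  fixes M :: "'a measure"
    and lam\<^sub>l lam\<^sub>v \<theta>\<^sub>0 :: real
    and \<Phi> :: "'a \<Rightarrow> (real \<times> real) set"
    and L :: "nat \<Rightarrow> 'a \<Rightarrow> real \<times> real"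
    and N :: "nat option \<Rightarrow> 'a \<Rightarrow> real set"
    and E\<^sub>0 :: "'a set"
    and S\<^sub>0 V\<^sub>0 R :: "'a \<Rightarrow> real"
  assumes "poisson_line_cox M lam\<^sub>l lam\<^sub>v \<Phi> L N"
    and "S\<^sub>0 = S0_dist \<theta>\<^sub>0 N"
    and "V\<^sub>0 = V0_dist L N"
    and "R = serving_dist \<theta>\<^sub>0 L N"
    and "E\<^sub>0 = serving_on_typical M \<theta>\<^sub>0 L N"
  shows
    "(\<forall>s. cdf (distr M borel S\<^sub>0) s = F_S0 lam\<^sub>v s) \<and>
     distributed M lborel S\<^sub>0 (\<lambda>s. ennreal (f_S0 lam\<^sub>v s)) \<and>
     distributed M lborel V\<^sub>0 (\<lambda>v. ennreal (f_V0 lam\<^sub>l lam\<^sub>v v)) \<and>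
     measure M E\<^sub>0 = (LBINT v\<^sub>0:{0..}. F_S0 lam\<^sub>v v\<^sub>0 * f_V0 lam\<^sub>l lam\<^sub>v v\<^sub>0) \<and>
     (\<forall>r\<ge>0. cdf (distr (uniform_measure M E\<^sub>0) borel R) r =
        1 - 1 / measure M E\<^sub>0 *
          (LBINT v\<^sub>0:{r..}. (F_S0 lam\<^sub>v v\<^sub>0 - F_S0 lam\<^sub>v r) * f_V0 lam\<^sub>l lam\<^sub>v v\<^sub>0)) \<and>
     distributed (uniform_measure M E\<^sub>0) lborel R
       (\<lambda>r. ennreal (if r < 0 then 0 else
          1 / measure M E\<^sub>0 * (LBINT v\<^sub>0:{r..}. f_S0 lam\<^sub>v r * f_V0 lam\<^sub>l lam\<^sub>v v\<^sub>0)))"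
proof -
  interpret poisson_line_cox M lam\<^sub>l lam\<^sub>v \<Phi> L N by fact
  show ?thesis
    unfolding assms(2-5)
    by (intro conjI allI impI cdf_S0 distributed_S0 distributed_V0 prob_serving_on_typical
        cdf_serving_dist distributed_serving_dist)
qed

end
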